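(* Let $x_1,\dots,x_n\in\mathbb{M}_r$ be points of the hyperboloid model whose pairwise distances $d_H(x_i,x_j)$ are observed, and let $Y\in\mathbb{R}^{n\times n}$ be given by $Y_{i,j}=\cosh(d_H(x_i,x_j))$. Let $X\in\mathbb{R}^{n\times r}$ be the matrix with $i$-th row $\vec{x}_i$ and $u\in\mathbb{R}^n$ the vector with $u_i=x_{0,i}$. Then $$Y=uu^T-XX^T.$$ Without loss of generality (by applying an isometry, which does not affect the pairwise distances) the points can be supposed to be centered at their pseudo-Euclidean mean, so that $X^Tu=0$. Then $u$ is an eigenvector of $Y$ with positive eigenvalue, and the rest of $Y$'s eigenvalues are negative. Therefore an eigendecomposition of $Y$ finds $u,\hat X$ such that $Y=uu^T-\hat X\hat X^T$, i.e. it directly recovers $X$ up to rotation. In fact, running PCA on $-Y=XX^T-uu^T$ to find the $r$ most significant non-negative eigenvectors recovers $X$ up to rotation, and then $u$ can be found from $x_0=\sqrt{1+\|\vec{x}\|^2}$.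
   Context: Let $Q$ be the $(r+1)\times(r+1)$ diagonal matrix, indices $0,\dots,r$, with $Q_{00}=1$ and $Q_{ii}=-1$ for $i>0$. The hyperboloid model is $\mathbb{M}_r=\{x\in\mathbb{R}^{r+1}: x^TQx=1,\ x_0>0\}$ with distance $d_H(x,y)=\operatorname{acosh}(x^TQy)$. For $x_i\in\mathbb{M}_r$, $x_{0,i}$ denotes its $0$-th coordinate and $\vec{x}_i\in\mathbb{R}^r$ the vector of its remaining coordinates, so $x_{0,i}=\sqrt{1+\|\vec{x}_i\|^2}$. A pseudo-Euclidean mean of $x_1,\dots,x_n$ is any local minimum $z\in\mathbb{M}_r$ of $\Psi(z;x_1,\dots,x_n)=\sum_{i=1}^n\sinh^2(d_H(x_i,z))$. The points are called pseudo-Euclidean centered if their average in this sense is $0$ (the point with $\vec{z}=0$), i.e. if $X^Tu=\sum_i x_{0,i}\vec{x}_i=0$. Running PCA on a symmetric matrix with target rank $r$ means taking its $r$ most significant eigenvectors with non-negative eigenvalue, each scaled by the square root of its eigenvalue, as the columns of an $n\times r$ matrix.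
   Formalization: "The rest of Y's eigenvalues are negative" is false (two points at the origin give eigenvalues 2, 0); proved instead: the rest are non-positive, and eigenvectors w with eigenvalue 0 satisfy X^T w = 0. The eigendecomposition gives u up to sign; "rotation" means an orthogonal matrix. *)

theory Defs
  imports "Jordan_Normal_Form.Char_Poly"
begin

text \<open>Points and matrix rows are indexed from 0: the points are \<open>x 0, \<dots>, x (n - 1)\<close>,
  and coordinate 0 of a vector of dimension \<open>r + 1\<close> is the time coordinate.\<close>

definition Q_mat :: "nat \<Rightarrow> real mat" where
  "Q_mat r = mat (r + 1) (r + 1) (\<lambda>(i, j). if i = j then (if i = 0 then 1 else - 1) else 0)"

definition Q_form :: "nat \<Rightarrow> real vec \<Rightarrow> real vec \<Rightarrow> real" where
  "Q_form r x y = x \<bullet> (Q_mat r *\<^sub>v y)"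

definition hyperboloid :: "nat \<Rightarrow> real vec set" where
  "hyperboloid r = {x \<in> carrier_vec (r + 1). Q_form r x x = 1 \<and> x $ 0 > 0}"

definition hyp_dist :: "nat \<Rightarrow> real vec \<Rightarrow> real vec \<Rightarrow> real" where
  "hyp_dist r x y = arcosh (Q_form r x y)"

definition hyp_origin :: "nat \<Rightarrow> real vec" where
  "hyp_origin r = unit_vec (r + 1) 0"

definition hyp_isometry :: "nat \<Rightarrow> (real vec \<Rightarrow> real vec) \<Rightarrow> bool" where
  "hyp_isometry r T \<longleftrightarrow> bij_betw T (hyperboloid r) (hyperboloid r) \<and>
     (\<forall>x \<in> hyperboloid r. \<forall>y \<in> hyperboloid r. hyp_dist r (T x) (T y) = hyp_dist r x y)"

definition Psi :: "nat \<Rightarrow> nat \<Rightarrow> (nat \<Rightarrow> real vec) \<Rightarrow> real vec \<Rightarrow> real" where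
  "Psi r n x z = (\<Sum>i<n. (sinh (hyp_dist r (x i) z))\<^sup>2)"

text \<open>Local minimality is with respect to the metric \<open>hyp_dist r\<close> of the hyperboloid
  (vectors of type \<open>real vec\<close> carry no topology).\<close>

definition pe_mean :: "nat \<Rightarrow> nat \<Rightarrow> (nat \<Rightarrow> real vec) \<Rightarrow> real vec \<Rightarrow> bool" where
  "pe_mean r n x z \<longleftrightarrow> z \<in> hyperboloid r \<and>
     (\<exists>\<epsilon>>0. \<forall>w \<in> hyperboloid r. hyp_dist r z w < \<epsilon> \<longrightarrow> Psi r n x z \<le> Psi r n x w)"

definition pe_centered :: "nat \<Rightarrow> nat \<Rightarrow> (nat \<Rightarrow> real vec) \<Rightarrow> bool" where
  "pe_centered r n x \<longleftrightarrow> pe_mean r n x (hyp_origin r)"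

definition cosh_dist_mat :: "nat \<Rightarrow> nat \<Rightarrow> (nat \<Rightarrow> real vec) \<Rightarrow> real mat" where
  "cosh_dist_mat r n x = mat n n (\<lambda>(i, j). cosh (hyp_dist r (x i) (x j)))"

definition spatial_mat :: "nat \<Rightarrow> nat \<Rightarrow> (nat \<Rightarrow> real vec) \<Rightarrow> real mat" where
  "spatial_mat r n x = mat n r (\<lambda>(i, k). x i $ (k + 1))"

definition time_vec :: "nat \<Rightarrow> (nat \<Rightarrow> real vec) \<Rightarrow> real vec" where
  "time_vec n x = vec n (\<lambda>i. x i $ 0)"

definition outer :: "real vec \<Rightarrow> real mat" where
  "outer u = mat (dim_vec u) (dim_vec u) (\<lambda>(i, j). u $ i * u $ j)"

definition orthogonal_group :: "nat \<Rightarrow> real mat set" where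
  "orthogonal_group r = {R \<in> carrier_mat r r. transpose_mat R * R = 1\<^sub>m r}"

text \<open>An eigendecomposition of a symmetric matrix: an orthonormal basis \<open>v 0, \<dots>, v (n - 1)\<close> of
  eigenvectors, listed so that the eigenvalues \<open>l 0, \<dots>, l (n - 1)\<close> are decreasing.\<close>

definition eigendecomposition :: "real mat \<Rightarrow> (nat \<Rightarrow> real vec) \<Rightarrow> (nat \<Rightarrow> real) \<Rightarrow> bool" where
  "eigendecomposition A v l \<longleftrightarrow>
     (\<forall>k < dim_row A. eigenvector A (v k) (l k)) \<and>
     (\<forall>j < dim_row A. \<forall>k < dim_row A. v j \<bullet> v k = (if j = k then 1 else 0)) \<and>
     (\<forall>j k. j \<le> k \<and> k < dim_row A \<longrightarrow> l k \<le> l j)"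

text \<open>If fewer than \<open>r\<close> eigenvectors with non-negative eigenvalue exist, the result is
  padded by zero columns. The result is a relation because neither the signs of eigenvectors nor
  the bases of eigenspaces are determined.\<close>

definition pca :: "nat \<Rightarrow> real mat \<Rightarrow> real mat \<Rightarrow> bool" where
  "pca r A Xh \<longleftrightarrow> (\<exists>v l. eigendecomposition A v l \<and>
     Xh = mat (dim_row A) r
       (\<lambda>(i, k). if k < dim_row A \<and> l k \<ge> 0 then sqrt (l k) * v k $ i else 0))"

text \<open>The factors read off from an eigendecomposition of \<open>Y\<close>: the scaled top eigenvector, and
  the scaled eigenvectors of the (up to) \<open>r\<close> smallest of the remaining eigenvalues
  \<open>l (n - 1), \<dots>, l 1\<close>, again padded by zero columns.\<close>

definition eig_time :: "(nat \<Rightarrow> real vec) \<Rightarrow> (nat \<Rightarrow> real) \<Rightarrow> real vec" where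
  "eig_time v l = sqrt (l 0) \<cdot>\<^sub>v v 0"

definition eig_spatial :: "nat \<Rightarrow> nat \<Rightarrow> (nat \<Rightarrow> real vec) \<Rightarrow> (nat \<Rightarrow> real) \<Rightarrow> real mat" where
  "eig_spatial r n v l = mat n r
     (\<lambda>(i, k). if k + 1 < n then sqrt (- l (n - 1 - k)) * v (n - 1 - k) $ i else 0)"

definition time_of_spatial :: "real mat \<Rightarrow> real vec" where
  "time_of_spatial Xh = vec (dim_row Xh) (\<lambda>i. sqrt (1 + row Xh i \<bullet> row Xh i))"

end

theory Submission
  imports Defs "Jordan_Normal_Form.Spectral_Radius"
begin

text \<open>Since \<open>cosh (d\<^sub>H x y) = x\<^sup>T Q y\<close> on the hyperboloid, \<open>Y = u u\<^sup>T - X X\<^sup>T\<close>, and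
  \<open>\<Psi> z + n = \<Sum>\<^sub>i (x\<^sub>i\<^sup>T Q z)\<^sup>2\<close> is a quadratic form in \<open>z\<close> with gradient \<open>- 2 X\<^sup>T u\<close> at the origin.
  A mean is the normalised combination \<open>\<Sum>\<^sub>i w\<^sub>i x\<^sub>i\<close> for an eigenvector \<open>w\<close> of \<open>Y\<close> with positive
  eigenvalue, and a half-turn moves it to the origin. If \<open>X\<^sup>T u = 0\<close>, then \<open>Y u = (u \<bullet> u) u\<close> and
  \<open>Y\<close> acts as \<open>- X X\<^sup>T\<close> on the orthogonal complement of \<open>u\<close>, so an eigendecomposition separates
  \<open>u\<close> from a factor with the same Gram matrix as \<open>X\<close>; two such factors differ by an orthogonal
  matrix, a product of reflections.\<close>

section \<open>Reflections and Gram matrices\<close>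

text \<open>Eigenvalues of \<open>Y\<close> other than \<open>u \<bullet> u\<close> may vanish,
  since \<open>Y\<close> has rank at most \<open>r + 1\<close> and \<open>X\<close> may itself have
  rank below \<open>r\<close>. This is harmless: eigenvectors for the eigenvalue 0 contribute
  nothing to a factor of \<open>X X^T\<close>, so it suffices that at most \<open>r\<close>
  eigenvalues are negative. An eigendecomposition leaves the sign of \<open>u\<close> open; on the
  PCA route the positivity of the time coordinates settles it. Real vectors of variable dimension
  carry no topology here, so a minimiser of \<open>Psi\<close> is not obtained by compactness but
  built algebraically. That a critical point is a minimum is then checked at the origin only, where
  \<open>Psi\<close> is visibly bounded below by its value there, and carried elsewhere by an
  isometry.\<close>

text \<open>A left inverse of a square matrix is also a right inverse, which yields the third
  equation. For a matrix of eigenvectors it turns orthonormality into completeness.\<close>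

lemma orthogonal_groupD:
  assumes "R \<in> orthogonal_group n"
  shows "R \<in> carrier_mat n n" "transpose_mat R * R = 1\<^sub>m n" "R * transpose_mat R = 1\<^sub>m n"
  using assms mat_mult_left_right_inverse[of "transpose_mat R" n R]
  by (auto simp: orthogonal_group_def)

lemma orthogonal_group_mult:
  assumes "R \<in> orthogonal_group n" and "S \<in> orthogonal_group n"
  shows "R * S \<in> orthogonal_group n"
proof -
  note R = orthogonal_groupD[OF assms(1)] and S = orthogonal_groupD[OF assms(2)]
  have "transpose_mat (R * S) * (R * S) = (transpose_mat S * transpose_mat R) * (R * S)"
    using R(1) S(1) by (simp add: transpose_mult)
  also have "\<dots> = transpose_mat S * ((transpose_mat R * R) * S)"
    using R(1) S(1) by (simp add: assoc_mult_mat[of _ n n _ n _ n] del: R(2))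
  also have "\<dots> = 1\<^sub>m n"
    using R(2) S(1,2) by simp
  finally show ?thesis
    using R(1) S(1) by (simp add: orthogonal_group_def)
qed

lemma orthogonal_group_transpose:
  assumes "R \<in> orthogonal_group n"
  shows "transpose_mat R \<in> orthogonal_group n"
  using orthogonal_groupD[OF assms] by (simp add: orthogonal_group_def)

lemma orthogonal_group_scalar_prod:
  assumes R: "R \<in> orthogonal_group n" and x: "x \<in> carrier_vec n" and y: "y \<in> carrier_vec n"
  shows "(R *\<^sub>v x) \<bullet> (R *\<^sub>v y) = x \<bullet> y"
proof -
  note R' = orthogonal_groupD[OF R]
  have "(R *\<^sub>v x) \<bullet> (R *\<^sub>v y) = (transpose_mat R *\<^sub>v (R *\<^sub>v x)) \<bullet> y"
    using transpose_vec_mult_scalar[OF R'(1) y, of "R *\<^sub>v x"] R'(1) x by simp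
  also have "transpose_mat R *\<^sub>v (R *\<^sub>v x) = x"
    using R' x assoc_mult_mat_vec[of "transpose_mat R" n n R n x] by simp
  finally show ?thesis .
qed

lemma scalar_prod_self_eq_0:
  fixes x :: "real vec"
  assumes "x \<in> carrier_vec n" and "x \<bullet> x = 0"
  shows "x = 0\<^sub>v n"
proof (rule eq_vecI)
  fix i assume i: "i < dim_vec (0\<^sub>v n :: real vec)"
  have "(\<Sum>j\<in>{0..<n}. (x $ j)\<^sup>2) = 0"
    using assms by (simp add: scalar_prod_def power2_eq_square)
  then show "x $ i = 0\<^sub>v n $ i"
    using i by (simp add: sum_nonneg_eq_0_iff)
qed (use assms in simp)

lemma scalar_prod_self_nonneg: "0 \<le> x \<bullet> (x :: real vec)"
  by (auto simp: scalar_prod_def intro!: sum_nonneg)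

lemma scalar_prod_self_pos:
  fixes x :: "real vec"
  assumes "x \<in> carrier_vec n" and "x \<noteq> 0\<^sub>v n"
  shows "0 < x \<bullet> x"
  using scalar_prod_self_eq_0[OF assms(1)] assms(2) scalar_prod_self_nonneg[of x] by fastforce

text \<open>\<open>H\<close> is the reflection in the hyperplane orthogonal to \<open>w = x - y\<close>; for \<open>x = y\<close> the
  convention \<open>2 / 0 = 0\<close> makes it the identity.\<close>

lemma reflection_exists:
  fixes x y :: "real vec"
  assumes x: "x \<in> carrier_vec n" and y: "y \<in> carrier_vec n" and eq: "x \<bullet> x = y \<bullet> y"
  obtains H where "H \<in> orthogonal_group n" "H *\<^sub>v x = y"
    "\<And>z. z \<in> carrier_vec n \<Longrightarrow> z \<bullet> x = z \<bullet> y \<Longrightarrow> H *\<^sub>v z = z"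
proof -
  define w where "w = x - y"
  define c where "c = 2 / (w \<bullet> w)"
  define H where "H = mat n n (\<lambda>(i, j). (if i = j then 1 else 0) - c * w $ i * w $ j)"
  have w: "w \<in> carrier_vec n" using x y by (simp add: w_def)
  have H: "H \<in> carrier_mat n n" by (simp add: H_def)
  have Hv: "H *\<^sub>v z = z - (c * (w \<bullet> z)) \<cdot>\<^sub>v w" if z: "z \<in> carrier_vec n" for z
  proof (rule eq_vecI)
    fix i assume "i < dim_vec (z - (c * (w \<bullet> z)) \<cdot>\<^sub>v w)"
    then have i: "i < n" using w by simp
    have "(H *\<^sub>v z) $ i = (\<Sum>j\<in>{0..<n}. ((if i = j then 1 else 0) - c * w $ i * w $ j) * z $ j)"
      using i z by (simp add: H_def scalar_prod_def)
    also have "\<dots> = (\<Sum>j\<in>{0..<n}. (if i = j then z $ j else 0) - c * w $ i * (w $ j * z $ j))"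
      by (rule sum.cong) (auto simp: algebra_simps)
    also have "\<dots> = (\<Sum>j\<in>{0..<n}. if i = j then z $ j else 0) - c * w $ i * (\<Sum>j\<in>{0..<n}. w $ j * z $ j)"
      by (simp only: sum_subtractf sum_distrib_left)
    also have "\<dots> = z $ i - c * w $ i * (w \<bullet> z)"
      using i z by (simp add: scalar_prod_def)
    finally show "(H *\<^sub>v z) $ i = (z - (c * (w \<bullet> z)) \<cdot>\<^sub>v w) $ i"
      using i z w by simp
  qed (use H w in simp)
  \<comment> \<open>By this identity the quadratic term of \<open>H^T H\<close> cancels the two
    linear ones, also for \<open>w = 0\<close>.\<close>
  have cc: "c * c * (w \<bullet> w) = 2 * c" by (simp add: c_def)
  have "transpose_mat H * H = 1\<^sub>m n"
  proof (rule eq_matI)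
    fix i j assume "i < dim_row (1\<^sub>m n :: real mat)" "j < dim_col (1\<^sub>m n :: real mat)"
    then have i: "i < n" and j: "j < n" by auto
    have "(transpose_mat H * H) $$ (i, j)
        = (\<Sum>k\<in>{0..<n}. ((if k = i then 1 else 0) - c * w $ k * w $ i) * ((if k = j then 1 else 0) - c * w $ k * w $ j))"
      using i j by (simp add: H_def scalar_prod_def)
    also have "\<dots> = (\<Sum>k\<in>{0..<n}. (if k = i then (if i = j then 1 else 0) - c * w $ i * w $ j else 0)
        - (if k = j then c * w $ j * w $ i else 0) + c * c * w $ i * w $ j * (w $ k * w $ k))"
      by (rule sum.cong) (auto simp: algebra_simps)
    also have "\<dots> = (if i = j then 1 else 0) - 2 * c * w $ i * w $ j
        + c * c * w $ i * w $ j * (w \<bullet> w)"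
      using i j w by (simp add: sum.distrib sum_subtractf sum_distrib_left scalar_prod_def)
    also have "\<dots> = (if i = j then 1 else 0) - 2 * c * w $ i * w $ j
        + (c * c * (w \<bullet> w)) * w $ i * w $ j"
      by (simp only: ac_simps)
    also have "\<dots> = 1\<^sub>m n $$ (i, j)" using i j by (simp add: cc)
    finally show "(transpose_mat H * H) $$ (i, j) = 1\<^sub>m n $$ (i, j)" .
  qed (use H in auto)
  then have "H \<in> orthogonal_group n" using H by (simp add: orthogonal_group_def)
  moreover have "H *\<^sub>v z = z" if "z \<in> carrier_vec n" "z \<bullet> x = z \<bullet> y" for z
  proof -
    have "w \<bullet> z = z \<bullet> w" using w that(1) by (rule comm_scalar_prod)
    also have "\<dots> = 0" using that x y by (simp add: w_def scalar_prod_minus_distrib[of _ n])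
    finally have "w \<bullet> z = 0" .
    then show ?thesis using Hv[OF that(1)] that(1) w by (auto intro: eq_vecI)
  qed
  moreover have "H *\<^sub>v x = y"
  proof (cases "x = y")
    case True
    then show ?thesis using Hv[OF x] x w by (auto simp: w_def)
  next
    case False
    have ww: "w \<bullet> w \<noteq> 0"
    proof
      assume "w \<bullet> w = 0"
      then have w0: "x - y = 0\<^sub>v n" using scalar_prod_self_eq_0[OF w] by (simp add: w_def)
      have "x = y"
      proof (rule eq_vecI)
        fix i assume "i < dim_vec y"
        then show "x $ i = y $ i" using arg_cong[OF w0, of "\<lambda>v. v $ i"] x y by simp
      qed (use x y in simp)
      then show False using False by simp
    qed
    \<comment> \<open>Equality of the norms enters here: both sides are
      \<open>2 * (x \<bullet> x - x \<bullet> y)\<close>, so that \<open>H\<close> subtracts exactly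
      \<open>w\<close> from \<open>x\<close>.\<close>
    have "w \<bullet> w = 2 * (w \<bullet> x)"
      using x y eq by (simp add: w_def minus_scalar_prod_distrib[of _ n] scalar_prod_minus_distrib[of _ n]
          comm_scalar_prod[of x n y])
    then have "c * (w \<bullet> x) = 1" using ww by (simp add: c_def)
    then have "H *\<^sub>v x = x - w" using Hv[OF x] by simp
    then show ?thesis using x y by (auto simp: w_def)
  qed
  ultimately show ?thesis using that by blast
qed

text \<open>The isometry is built one vector at a time: a reflection that moves the image of the next
  vector into place fixes the vectors that have been placed already, since the difference vector
  is orthogonal to them.\<close>

lemma equal_gram_imp_orthogonal:
  fixes a b :: "nat \<Rightarrow> real vec"
  assumes "\<And>i. i < k \<Longrightarrow> a i \<in> carrier_vec n" and "\<And>i. i < k \<Longrightarrow> b i \<in> carrier_vec n"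
    and "\<And>i j. i < k \<Longrightarrow> j < k \<Longrightarrow> a i \<bullet> a j = b i \<bullet> b j"
  shows "\<exists>R \<in> orthogonal_group n. \<forall>i<k. R *\<^sub>v a i = b i"
  using assms
proof (induction k)
  case 0
  have "1\<^sub>m n \<in> orthogonal_group n" by (simp add: orthogonal_group_def)
  then show ?case by auto
next
  case (Suc k)
  then obtain R where R: "R \<in> orthogonal_group n" and Ra: "\<And>i. i < k \<Longrightarrow> R *\<^sub>v a i = b i"
    by (metis less_Suc_eq)
  note Rc = orthogonal_groupD(1)[OF R]
  have R_prod: "(R *\<^sub>v a i) \<bullet> (R *\<^sub>v a k) = b i \<bullet> b k" if "i \<le> k" for i
    using that Suc.prems(3)[of i k] by (simp add: orthogonal_group_scalar_prod[OF R] Suc.prems(1))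
  obtain H where H: "H \<in> orthogonal_group n" and Hk: "H *\<^sub>v (R *\<^sub>v a k) = b k"
    and fix_H: "\<And>z. z \<in> carrier_vec n \<Longrightarrow> z \<bullet> (R *\<^sub>v a k) = z \<bullet> b k \<Longrightarrow> H *\<^sub>v z = z"
    using reflection_exists[of "R *\<^sub>v a k" n "b k"] R_prod[of k] Rc Suc.prems(1,2)[of k] by auto
  have "(H * R) *\<^sub>v a i = b i" if "i < Suc k" for i
  proof -
    have "(H * R) *\<^sub>v a i = H *\<^sub>v (R *\<^sub>v a i)"
      using orthogonal_groupD(1)[OF H] Rc Suc.prems(1)[OF that] by simp
    also have "\<dots> = b i"
    proof (cases "i = k")
      case False
      then have "i < k" using that by simp
      then show ?thesis using Ra R_prod[of i] fix_H[of "b i"] Suc.prems(2)[of i] by simp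
    qed (use Hk in simp)
    finally show ?thesis .
  qed
  then show ?case using orthogonal_group_mult[OF H R] by blast
qed

text \<open>The entries of \<open>A A^T\<close> are the inner products of the rows of
  \<open>A\<close>, so one orthogonal matrix moves all rows. It acts on them as column vectors,
  hence its transpose appears to the right of \<open>A\<close>.\<close>

lemma equal_gram_mat_imp_orthogonal:
  fixes A B :: "real mat"
  assumes A: "A \<in> carrier_mat m n" and B: "B \<in> carrier_mat m n"
    and eq: "A * transpose_mat A = B * transpose_mat B"
  shows "\<exists>R \<in> orthogonal_group n. B = A * R"
proof -
  have "row A i \<bullet> row A j = row B i \<bullet> row B j" if "i < m" "j < m" for i j
    using arg_cong[OF eq, of "\<lambda>M. M $$ (i, j)"] that A B by simp
  then obtain R where R: "R \<in> orthogonal_group n" and row: "\<And>i. i < m \<Longrightarrow> R *\<^sub>v row A i = row B i"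
    using equal_gram_imp_orthogonal[of m "row A" n "row B"] A B by auto
  note Rc = orthogonal_groupD(1)[OF R]
  have "B = A * transpose_mat R"
  proof (rule eq_matI)
    fix i j assume "i < dim_row (A * transpose_mat R)" "j < dim_col (A * transpose_mat R)"
    then have i: "i < m" and j: "j < n" using A Rc by auto
    have "B $$ (i, j) = (R *\<^sub>v row A i) $ j" using row[OF i] i j B by simp
    also have "\<dots> = (A * transpose_mat R) $$ (i, j)"
      using i j A Rc by (simp add: comm_scalar_prod[of _ n])
    finally show "B $$ (i, j) = (A * transpose_mat R) $$ (i, j)" .
  qed (use A B Rc in auto)
  then show ?thesis using orthogonal_group_transpose[OF R] by blast
qed

section \<open>Spectral theorem for real symmetric matrices\<close>

lemma symmetric_mat_scalar_prod:
  fixes A :: "real mat"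
  assumes A: "A \<in> carrier_mat n n" and sym: "transpose_mat A = A"
    and x: "x \<in> carrier_vec n" and y: "y \<in> carrier_vec n"
  shows "(A *\<^sub>v x) \<bullet> y = x \<bullet> (A *\<^sub>v y)"
  using transpose_vec_mult_scalar[OF A y x] by (simp add: sym)

text \<open>Over the complex numbers an eigenvector \<open>z = a + i b\<close> exists. Comparing
  \<open>(A a) \<bullet> b\<close> with \<open>a \<bullet> (A b)\<close> forces
  \<open>Im \<alpha> = 0\<close>, and then whichever of \<open>a\<close>, \<open>b\<close> is
  nonzero is a real eigenvector.\<close>

lemma symmetric_real_mat_unit_eigenvector:
  fixes A :: "real mat"
  assumes A: "A \<in> carrier_mat n n" and sym: "transpose_mat A = A" and n: "n > 0"
  obtains v l where "v \<in> carrier_vec n" "v \<bullet> v = 1" "A *\<^sub>v v = l \<cdot>\<^sub>v v"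
proof -
  define C where "C = map_mat complex_of_real A"
  have C: "C \<in> carrier_mat n n" using A by (simp add: C_def)
  obtain \<alpha> z where z: "z \<in> carrier_vec n" "z \<noteq> 0\<^sub>v n" and Cz: "C *\<^sub>v z = \<alpha> \<cdot>\<^sub>v z"
    using spectrum_non_empty[OF C n] C by (auto simp: spectrum_def eigenvalue_def eigenvector_def)
  define a b where "a = map_vec Re z" and "b = map_vec Im z"
  have a: "a \<in> carrier_vec n" and b: "b \<in> carrier_vec n" using z by (auto simp: a_def b_def)
  have Czi: "(\<Sum>j\<in>{0..<n}. complex_of_real (A $$ (i, j)) * z $ j) = \<alpha> * z $ i" if "i < n" for i
    using arg_cong[OF Cz, of "\<lambda>v. v $ i"] that A z by (simp add: C_def scalar_prod_def)
  have Aa: "A *\<^sub>v a = Re \<alpha> \<cdot>\<^sub>v a - Im \<alpha> \<cdot>\<^sub>v b"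
  proof (rule eq_vecI)
    fix i assume "i < dim_vec (Re \<alpha> \<cdot>\<^sub>v a - Im \<alpha> \<cdot>\<^sub>v b)"
    then have i: "i < n" using b by simp
    show "(A *\<^sub>v a) $ i = (Re \<alpha> \<cdot>\<^sub>v a - Im \<alpha> \<cdot>\<^sub>v b) $ i"
      using arg_cong[OF Czi[OF i], of Re] i z A by (simp add: a_def b_def scalar_prod_def)
  qed (use A b in simp)
  have Ab: "A *\<^sub>v b = Re \<alpha> \<cdot>\<^sub>v b + Im \<alpha> \<cdot>\<^sub>v a"
  proof (rule eq_vecI)
    fix i assume "i < dim_vec (Re \<alpha> \<cdot>\<^sub>v b + Im \<alpha> \<cdot>\<^sub>v a)"
    then have i: "i < n" using a by simp
    show "(A *\<^sub>v b) $ i = (Re \<alpha> \<cdot>\<^sub>v b + Im \<alpha> \<cdot>\<^sub>v a) $ i"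
      using arg_cong[OF Czi[OF i], of Im] i z A by (simp add: a_def b_def scalar_prod_def)
  qed (use A a in simp)
  have ab0: "a \<noteq> 0\<^sub>v n \<or> b \<noteq> 0\<^sub>v n"
  proof (rule ccontr)
    assume "\<not> ?thesis"
    then have ab: "a = 0\<^sub>v n" "b = 0\<^sub>v n" by auto
    have "z = 0\<^sub>v n"
    proof (rule eq_vecI)
      fix i assume "i < dim_vec (0\<^sub>v n :: complex vec)"
      then show "z $ i = 0\<^sub>v n $ i"
        using arg_cong[OF ab(1), of "\<lambda>v. v $ i"] arg_cong[OF ab(2), of "\<lambda>v. v $ i"] z
        by (simp add: a_def b_def complex_eq_iff)
    qed (use z in simp)
    then show False using z by simp
  qed
  have pos: "a \<bullet> a + b \<bullet> b > 0"
    using ab0 scalar_prod_self_pos[OF a] scalar_prod_self_pos[OF b]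
      scalar_prod_self_nonneg[of a] scalar_prod_self_nonneg[of b] by fastforce
  have "(A *\<^sub>v a) \<bullet> b = a \<bullet> (A *\<^sub>v b)" by (rule symmetric_mat_scalar_prod[OF A sym a b])
  then have "Im \<alpha> * (a \<bullet> a + b \<bullet> b) = 0"
    using a b by (simp add: Aa Ab minus_scalar_prod_distrib[of _ n] scalar_prod_add_distrib[of _ n] algebra_simps)
  then have im: "Im \<alpha> = 0" using pos by simp
  obtain w where w: "w \<in> carrier_vec n" "w \<noteq> 0\<^sub>v n" "A *\<^sub>v w = Re \<alpha> \<cdot>\<^sub>v w"
  proof -
    have "A *\<^sub>v a = Re \<alpha> \<cdot>\<^sub>v a" using Aa a b im by (auto intro: eq_vecI)
    moreover have "A *\<^sub>v b = Re \<alpha> \<cdot>\<^sub>v b" using Ab a b im by (auto intro: eq_vecI)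
    ultimately show ?thesis using ab0 a b that by blast
  qed
  have ww: "w \<bullet> w > 0" using scalar_prod_self_pos[OF w(1,2)] .
  define v where "v = (1 / sqrt (w \<bullet> w)) \<cdot>\<^sub>v w"
  have "v \<bullet> v = 1" using ww w(1) by (simp add: v_def)
  moreover have "A *\<^sub>v v = Re \<alpha> \<cdot>\<^sub>v v"
    using w A by (simp add: v_def mult_mat_vec smult_smult_assoc mult.commute)
  ultimately show ?thesis using that[of v] w by (simp add: v_def)
qed

text \<open>Deflation: a reflection \<open>H\<close> takes the first basis vector to a unit
  eigenvector, so \<open>B = H^T A H\<close> has first column \<open>l e\<close> and, by symmetry,
  the corresponding first row. The remaining block \<open>A'\<close> is diagonalised by
  induction.\<close>

lemma symmetric_real_mat_diagonalizable:
  fixes A :: "real mat"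
  assumes "A \<in> carrier_mat n n" and "transpose_mat A = A"
  shows "\<exists>P \<in> orthogonal_group n. \<exists>d. A * P = P * mat_diag n d"
  using assms
proof (induction n arbitrary: A)
  case 0
  have "1\<^sub>m 0 \<in> orthogonal_group 0" by (simp add: orthogonal_group_def)
  moreover have "A * 1\<^sub>m 0 = 1\<^sub>m 0 * mat_diag 0 d" for d :: "nat \<Rightarrow> real"
    using 0 by (intro eq_matI) (auto simp: mat_diag_def)
  ultimately show ?case by blast
next
  case (Suc n)
  note A = Suc.prems
  define e where "e = (unit_vec (Suc n) 0 :: real vec)"
  have e: "e \<in> carrier_vec (Suc n)" by (simp add: e_def)
  obtain v l where v: "v \<in> carrier_vec (Suc n)" "v \<bullet> v = 1" "A *\<^sub>v v = l \<cdot>\<^sub>v v"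
    using symmetric_real_mat_unit_eigenvector[OF A] by blast
  obtain H where H: "H \<in> orthogonal_group (Suc n)" and He: "H *\<^sub>v e = v"
    using reflection_exists[OF e v(1)] v(2) by (auto simp: e_def)
  note H' = orthogonal_groupD[OF H]
  define B where "B = transpose_mat H * A * H"
  have B: "B \<in> carrier_mat (Suc n) (Suc n)" using H'(1) A(1) by (simp add: B_def)
  have AH: "A * H = H * B"
  proof -
    have "H * B = (H * transpose_mat H) * (A * H)"
      using H'(1) A(1) by (simp add: B_def assoc_mult_mat[of _ "Suc n" "Suc n" _ "Suc n" _ "Suc n"] del: H'(3))
    then show ?thesis using H' A by simp
  qed
  have symB: "transpose_mat B = B"
    using H'(1) A by (simp add: B_def transpose_mult[of _ "Suc n" "Suc n" _ "Suc n"]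
        assoc_mult_mat[of _ "Suc n" "Suc n" _ "Suc n" _ "Suc n"])
  have HB: "B *\<^sub>v e = l \<cdot>\<^sub>v e"
  proof -
    have "B *\<^sub>v e = transpose_mat H *\<^sub>v (A *\<^sub>v (H *\<^sub>v e))"
      using H'(1) A(1) e by (simp add: B_def assoc_mult_mat_vec[of _ "Suc n" "Suc n" _ "Suc n"])
    also have "\<dots> = l \<cdot>\<^sub>v (transpose_mat H *\<^sub>v (H *\<^sub>v e))"
      using He v H'(1) by (simp add: mult_mat_vec[of _ "Suc n" "Suc n"])
    also have "transpose_mat H *\<^sub>v (H *\<^sub>v e) = (transpose_mat H * H) *\<^sub>v e"
      using H'(1) e by (simp add: assoc_mult_mat_vec[of _ "Suc n" "Suc n" _ "Suc n"] del: H'(2))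
    finally show ?thesis using H'(2) e by simp
  qed
  have B0: "B $$ (i, 0) = (if i = 0 then l else 0)" if "i < Suc n" for i
    using arg_cong[OF HB, of "\<lambda>v. v $ i"] that B by (simp add: e_def)
  have B0': "B $$ (0, i) = (if i = 0 then l else 0)" if "i < Suc n" for i
    using B0[OF that] arg_cong[OF symB, of "\<lambda>M. M $$ (i, 0)"] that B by simp
  define A' where "A' = mat n n (\<lambda>(i, j). B $$ (Suc i, Suc j))"
  have A': "A' \<in> carrier_mat n n" by (simp add: A'_def)
  have symA': "transpose_mat A' = A'"
  proof (rule eq_matI)
    fix i j assume "i < dim_row A'" "j < dim_col A'"
    then show "transpose_mat A' $$ (i, j) = A' $$ (i, j)"
      using arg_cong[OF symB, of "\<lambda>M. M $$ (Suc i, Suc j)"] B by (simp add: A'_def)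
  qed (use A' in auto)
  obtain P d where P: "P \<in> orthogonal_group n" and PD: "A' * P = P * mat_diag n d"
    using Suc.IH[OF A' symA'] by blast
  note P' = orthogonal_groupD[OF P]
  let ?blk = "\<lambda>c M. four_block_mat (mat 1 1 (\<lambda>_. c :: real)) (0\<^sub>m 1 n) (0\<^sub>m n 1) M"
  have blk_mult: "?blk c M * ?blk c' M' = ?blk (c * c') (M * M')"
    if "M \<in> carrier_mat n n" "M' \<in> carrier_mat n n" for c c' M M'
  proof -
    have "mat 1 1 (\<lambda>_. c) * mat 1 1 (\<lambda>_. c') = mat 1 1 (\<lambda>_. c * c')"
      by (rule eq_matI) (auto simp: scalar_prod_def)
    then show ?thesis
      using that by (subst mult_four_block_mat[of _ 1 1 _ n _ n]) auto
  qed
  define F where "F = ?blk 1 P"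
  define D where "D = mat_diag (Suc n) (case_nat l d)"
  have F: "F \<in> carrier_mat (Suc n) (Suc n)" using P'(1) by (auto simp: F_def)
  have D: "D \<in> carrier_mat (Suc n) (Suc n)" by (simp add: D_def)
  have Bblk: "B = ?blk l A'"
    by (rule eq_matI) (use B B0 B0' in \<open>auto simp: A'_def\<close>)
  have Dblk: "D = ?blk l (mat_diag n d)"
    by (rule eq_matI) (auto simp: D_def mat_diag_def split: nat.splits)
  have one: "transpose_mat (mat (Suc 0) (Suc 0) (\<lambda>_. 1 :: real)) = mat (Suc 0) (Suc 0) (\<lambda>_. 1)"
    by (rule eq_matI) auto
  have F1: "F \<in> orthogonal_group (Suc n)"
  proof -
    have "transpose_mat F = ?blk 1 (transpose_mat P)"
      using P'(1) by (simp add: F_def one transpose_four_block_mat[of _ 1 1 _ n _ n])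
    then have "transpose_mat F * F = ?blk 1 (1\<^sub>m n)"
      using P' blk_mult[of "transpose_mat P" P 1 1] by (simp add: F_def)
    moreover have "?blk 1 (1\<^sub>m n) = 1\<^sub>m (Suc n)" by (rule eq_matI) auto
    ultimately show ?thesis using F by (simp add: orthogonal_group_def)
  qed
  have "B * F = F * D"
    using blk_mult[of A' P l 1] blk_mult[of P "mat_diag n d" 1 l] P'(1) A' PD by (simp add: F_def Bblk Dblk)
  moreover have "A * (H * F) = (A * H) * F"
    using A(1) H'(1) F by simp
  moreover have "(H * B) * F = H * (B * F)" and "H * (F * D) = (H * F) * D"
    using H'(1) B F D by simp_all
  ultimately have "A * (H * F) = (H * F) * D" using AH by simp
  then show ?case using orthogonal_group_mult[OF H F1] by (auto simp: D_def)
qed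

text \<open>The columns of a diagonalising matrix still have to be put in decreasing order of
  eigenvalue; sorting by \<open>- d k\<close> does this, and distinctness of \<open>ks\<close>
  preserves orthonormality.\<close>

lemma eigendecomposition_exists:
  fixes A :: "real mat"
  assumes A: "A \<in> carrier_mat n n" and sym: "transpose_mat A = A"
  shows "\<exists>v l. eigendecomposition A v l"
proof -
  obtain P d where P: "P \<in> orthogonal_group n" and AP: "A * P = P * mat_diag n d"
    using symmetric_real_mat_diagonalizable[OF A sym] by blast
  note P' = orthogonal_groupD[OF P]
  define ks where "ks = sort_key (\<lambda>k. - d k) [0..<n]"
  have ks: "length ks = n" "set ks = {0..<n}" "distinct ks" by (auto simp: ks_def)
  have sorted: "sorted (map (\<lambda>k. - d k) ks)" by (simp add: ks_def)
  have nth: "ks ! k < n" if "k < n" for k using ks that nth_mem[of k ks] by auto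
  define v l where "v k = col P (ks ! k)" and "l k = d (ks ! k)" for k
  have dot: "col P i \<bullet> col P j = (if i = j then 1 else 0)" if "i < n" "j < n" for i j
    using arg_cong[OF P'(2), of "\<lambda>M. M $$ (i, j)"] that P'(1) by simp
  have Acol: "A *\<^sub>v col P k = d k \<cdot>\<^sub>v col P k" if k: "k < n" for k
  proof -
    have "A *\<^sub>v col P k = col (A * P) k" by (rule col_mult2[OF A P'(1) k, symmetric])
    also have "\<dots> = d k \<cdot>\<^sub>v col P k"
      unfolding AP using P'(1) k
      by (intro eq_vecI) (auto simp: mat_diag_mult_right[of _ n n])
    finally show ?thesis .
  qed
  have "v k \<noteq> 0\<^sub>v n" if "k < n" for k
    using dot[OF nth[OF that] nth[OF that]] P'(1) by (auto simp: v_def)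
  then have "eigenvector A (v k) (l k)" if "k < n" for k
    using Acol[OF nth[OF that]] that A P'(1) by (auto simp: eigenvector_def v_def l_def)
  moreover have "v j \<bullet> v k = (if j = k then 1 else 0)" if "j < n" "k < n" for j k
    using dot[OF nth[OF that(1)] nth[OF that(2)]] ks that by (simp add: v_def nth_eq_iff_index_eq)
  moreover have "l k \<le> l j" if "j \<le> k" "k < n" for j k
    using sorted_nth_mono[OF sorted, of j k] that ks by (simp add: l_def)
  ultimately have "eigendecomposition A v l" using A by (simp add: eigendecomposition_def)
  then show ?thesis by blast
qed

section \<open>Consequences of an eigendecomposition: completeness, spectral expansion,
  characteristic polynomial\<close>

lemma eigendecomposition_carrier:
  assumes "A \<in> carrier_mat n n" and "eigendecomposition A v l" and "k < n"
  shows "v k \<in> carrier_vec n" and "A *\<^sub>v v k = l k \<cdot>\<^sub>v v k" and "eigenvector A (v k) (l k)"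
  using assms by (auto simp: eigendecomposition_def eigenvector_def)

lemma eigendecomposition_orthogonal:
  assumes A: "A \<in> carrier_mat n n" and vl: "eigendecomposition A v l"
  shows "mat n n (\<lambda>(i, k). v k $ i) \<in> orthogonal_group n"
proof -
  have "transpose_mat (mat n n (\<lambda>(i, k). v k $ i)) * mat n n (\<lambda>(i, k). v k $ i) = 1\<^sub>m n"
  proof (rule eq_matI)
    fix j k assume "j < dim_row (1\<^sub>m n :: real mat)" "k < dim_col (1\<^sub>m n :: real mat)"
    then have jk: "j < n" "k < n" by auto
    have "(transpose_mat (mat n n (\<lambda>(i, k). v k $ i)) * mat n n (\<lambda>(i, k). v k $ i)) $$ (j, k) = v j \<bullet> v k"
      using jk eigendecomposition_carrier(1)[OF A vl jk(2)] by (simp add: scalar_prod_def)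
    then show "(transpose_mat (mat n n (\<lambda>(i, k). v k $ i)) * mat n n (\<lambda>(i, k). v k $ i)) $$ (j, k) = 1\<^sub>m n $$ (j, k)"
      using vl A jk by (simp add: eigendecomposition_def)
  qed auto
  then show ?thesis by (simp add: orthogonal_group_def)
qed

text \<open>The relation \<open>P P^T = 1\<close> for the matrix \<open>P\<close> of eigenvectors,
  read entrywise: a resolution of the identity.\<close>

lemma eigendecomposition_complete:
  assumes A: "A \<in> carrier_mat n n" and vl: "eigendecomposition A v l" and ij: "i < n" "j < n"
  shows "(\<Sum>k<n. v k $ i * v k $ j) = (if i = j then 1 else 0)"
  using arg_cong[OF orthogonal_groupD(3)[OF eigendecomposition_orthogonal[OF A vl]], of "\<lambda>M. M $$ (i, j)"] ij
  by (simp add: scalar_prod_def atLeast0LessThan)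

text \<open>The resolution of the identity is inserted to the right of \<open>A\<close>, and the
  eigenvalue equation is applied to each term.\<close>

lemma eigendecomposition_entry:
  assumes A: "A \<in> carrier_mat n n" and vl: "eigendecomposition A v l" and ij: "i < n" "j < n"
  shows "A $$ (i, j) = (\<Sum>k<n. l k * v k $ i * v k $ j)"
proof -
  have Av: "(\<Sum>m<n. A $$ (i, m) * v k $ m) = l k * v k $ i" if "k < n" for k
    using arg_cong[OF eigendecomposition_carrier(2)[OF A vl that], of "\<lambda>w. w $ i"]
      eigendecomposition_carrier(1)[OF A vl that] A ij
    by (simp add: scalar_prod_def atLeast0LessThan)
  have "A $$ (i, j) = (\<Sum>m<n. if m = j then A $$ (i, m) else 0)"
    using ij by simp
  also have "\<dots> = (\<Sum>m<n. \<Sum>k<n. A $$ (i, m) * v k $ m * v k $ j)"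
    using eigendecomposition_complete[OF A vl _ ij(2)]
    by (intro sum.cong) (auto simp: sum_distrib_left[symmetric] mult.assoc)
  also have "\<dots> = (\<Sum>k<n. (\<Sum>m<n. A $$ (i, m) * v k $ m) * v k $ j)"
    unfolding sum_distrib_right by (rule sum.swap)
  also have "\<dots> = (\<Sum>k<n. l k * v k $ i * v k $ j)"
    by (intro sum.cong) (auto simp: Av)
  finally show ?thesis .
qed

text \<open>The matrix of eigenvectors conjugates \<open>A\<close> to a diagonal matrix, so the list
  of the \<open>l k\<close> contains every eigenvalue with its algebraic multiplicity.\<close>

lemma eigendecomposition_char_poly:
  assumes A: "A \<in> carrier_mat n n" and vl: "eigendecomposition A v l"
  shows "char_poly A = (\<Prod>e\<leftarrow>map l [0..<n]. [:- e, 1:])"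
proof -
  define P where "P = mat n n (\<lambda>(i, k). v k $ i)"
  define D where "D = mat_diag n l"
  have P: "P \<in> orthogonal_group n" unfolding P_def by (rule eigendecomposition_orthogonal[OF A vl])
  note P' = orthogonal_groupD[OF P]
  have D: "D \<in> carrier_mat n n" by (simp add: D_def)
  have "A = P * D * transpose_mat P"
  proof (rule eq_matI)
    fix i j assume "i < dim_row (P * D * transpose_mat P)" "j < dim_col (P * D * transpose_mat P)"
    then have ij: "i < n" "j < n" using P'(1) by auto
    have "(P * D * transpose_mat P) $$ (i, j) = (\<Sum>k<n. l k * v k $ i * v k $ j)"
      using ij P'(1) unfolding D_def mat_diag_mult_right[OF P'(1)]
      by (auto simp: P_def scalar_prod_def atLeast0LessThan intro!: sum.cong)
    then show "A $$ (i, j) = (P * D * transpose_mat P) $$ (i, j)"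
      using eigendecomposition_entry[OF A vl ij] by simp
  qed (use A P'(1) in auto)
  then have "similar_mat_wit A D P (transpose_mat P)"
    using A D P' by (intro similar_mat_witI[of _ _ n]) auto
  then have "char_poly A = char_poly D"
    by (intro char_poly_similar) (auto simp: similar_mat_def)
  also have "\<dots> = (\<Prod>e\<leftarrow>diag_mat D. [:- e, 1:])"
    by (rule char_poly_upper_triangular[OF D]) (auto simp: D_def mat_diag_def)
  also have "diag_mat D = map l [0..<n]"
    by (auto simp: diag_mat_def D_def mat_diag_def)
  finally show ?thesis .
qed

text \<open>Serves to limit the number of negative eigenvalues of \<open>Y\<close> by the number
  \<open>r\<close> of columns of \<open>X\<close>.\<close>

lemma orthonormal_length_le:
  fixes f :: "nat \<Rightarrow> real vec"
  assumes f: "\<And>j. j < m \<Longrightarrow> f j \<in> carrier_vec r"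
    and orth: "\<And>j k. j < m \<Longrightarrow> k < m \<Longrightarrow> f j \<bullet> f k = (if j = k then 1 else 0)"
  shows "m \<le> r"
proof (rule ccontr)
  assume "\<not> m \<le> r"
  then have rm: "r < m" by simp
  \<comment> \<open>Padding by zeros gives an orthogonal matrix with a zero row.\<close>
  define P where "P = mat m m (\<lambda>(i, k). if i < r then f k $ i else 0)"
  have "transpose_mat P * P = 1\<^sub>m m"
  proof (rule eq_matI)
    fix j k assume "j < dim_row (1\<^sub>m m :: real mat)" "k < dim_col (1\<^sub>m m :: real mat)"
    then have jk: "j < m" "k < m" by auto
    have "(transpose_mat P * P) $$ (j, k) = (\<Sum>i\<in>{0..<m}. if i < r then f j $ i * f k $ i else 0)"
      using jk by (auto simp: P_def scalar_prod_def intro!: sum.cong)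
    also have "\<dots> = (\<Sum>i\<in>{0..<r}. f j $ i * f k $ i)"
      using rm by (intro sum.mono_neutral_cong_right) auto
    also have "\<dots> = f j \<bullet> f k" using f[OF jk(2)] by (simp add: scalar_prod_def)
    finally show "(transpose_mat P * P) $$ (j, k) = 1\<^sub>m m $$ (j, k)" using orth jk by simp
  qed (auto simp: P_def)
  then have "P \<in> orthogonal_group m" by (simp add: orthogonal_group_def P_def)
  from arg_cong[OF orthogonal_groupD(3)[OF this], of "\<lambda>M. M $$ (r, r)"] rm
  show False by (simp add: P_def scalar_prod_def)
qed

section \<open>Eigenvectors of a centered matrix\<close>

text \<open>The spectral arguments see the points only through this factorization. The equation of
  the hyperboloid comes back when the time coordinates are computed from the spatial ones.\<close>

locale centered_factorization =
  fixes n r :: nat and X Y :: "real mat" and u :: "real vec"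
  assumes X: "X \<in> carrier_mat n r" and u: "u \<in> carrier_vec n" and u_nonzero: "u \<noteq> 0\<^sub>v n"
    and Y_eq: "Y = outer u - X * transpose_mat X"
    and centered: "transpose_mat X *\<^sub>v u = 0\<^sub>v r"
begin

lemma Y: "Y \<in> carrier_mat n n"
  using X u by (auto simp: Y_eq outer_def intro!: minus_carrier_mat)

lemma Y_sym: "transpose_mat Y = Y"
proof (rule eq_matI)
  fix i j assume "i < dim_row Y" "j < dim_col Y"
  then have "i < n" "j < n" using Y by auto
  then show "transpose_mat Y $$ (i, j) = Y $$ (i, j)"
    using X u by (simp add: Y_eq outer_def comm_scalar_prod[of "row X i" r "row X j"])
qed (use Y in auto)

lemma mu_pos: "0 < u \<bullet> u"
  by (rule scalar_prod_self_pos[OF u u_nonzero])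

lemma Y_mult:
  assumes w: "w \<in> carrier_vec n"
  shows "Y *\<^sub>v w = (u \<bullet> w) \<cdot>\<^sub>v u - X *\<^sub>v (transpose_mat X *\<^sub>v w)"
proof -
  have "outer u *\<^sub>v w = (u \<bullet> w) \<cdot>\<^sub>v u"
  proof (rule eq_vecI)
    fix i assume "i < dim_vec ((u \<bullet> w) \<cdot>\<^sub>v u)"
    then have "i < n" using u by simp
    then show "(outer u *\<^sub>v w) $ i = ((u \<bullet> w) \<cdot>\<^sub>v u) $ i"
      using u w by (simp add: outer_def scalar_prod_def sum_distrib_right sum_distrib_left mult.assoc mult.left_commute mult.commute)
  qed (use u in \<open>simp add: outer_def\<close>)
  moreover have "Y *\<^sub>v w = outer u *\<^sub>v w - (X * transpose_mat X) *\<^sub>v w"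
    unfolding Y_eq using X u w by (intro minus_mult_distrib_mat_vec[of _ n n]) (auto simp: outer_def)
  ultimately show ?thesis using X w by simp
qed

lemma Y_u: "Y *\<^sub>v u = (u \<bullet> u) \<cdot>\<^sub>v u"
proof -
  have "X *\<^sub>v 0\<^sub>v r = 0\<^sub>v n" using X by (intro eq_vecI) auto
  then show ?thesis using u by (simp add: Y_mult centered)
qed

lemma eigenvector_u: "eigenvector Y u (u \<bullet> u)"
  using Y u u_nonzero Y_u by (simp add: eigenvector_def)

lemma eigenvector_orthogonal:
  assumes "eigenvector Y w \<nu>" and "\<nu> \<noteq> u \<bullet> u"
  shows "u \<bullet> w = 0"
proof -
  have w: "w \<in> carrier_vec n" and Yw: "Y *\<^sub>v w = \<nu> \<cdot>\<^sub>v w"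
    using assms(1) Y by (auto simp: eigenvector_def)
  have "(Y *\<^sub>v u) \<bullet> w = u \<bullet> (Y *\<^sub>v w)" by (rule symmetric_mat_scalar_prod[OF Y Y_sym u w])
  then have "(u \<bullet> u) * (u \<bullet> w) = \<nu> * (u \<bullet> w)" using u w by (simp add: Y_u Yw)
  then show ?thesis using assms(2) by simp
qed

text \<open>Pairing the eigenvalue equation with \<open>w\<close> gives
  \<open>\<nu> * (w \<bullet> w) = - (y \<bullet> y)\<close> for \<open>y = X^T w\<close>. The zero
  case does occur: for \<open>n > r + 1\<close> the matrix \<open>Y\<close> has a nontrivial
  kernel.\<close>

lemma eigenvalue_orthogonal:
  assumes "eigenvector Y w \<nu>" and uw: "u \<bullet> w = 0"
  shows "\<nu> < 0 \<or> (\<nu> = 0 \<and> transpose_mat X *\<^sub>v w = 0\<^sub>v r)"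
proof -
  have w: "w \<in> carrier_vec n" and w0: "w \<noteq> 0\<^sub>v n" and Yw: "Y *\<^sub>v w = \<nu> \<cdot>\<^sub>v w"
    using assms(1) Y by (auto simp: eigenvector_def)
  let ?y = "transpose_mat X *\<^sub>v w"
  have y: "?y \<in> carrier_vec r" using X by (intro carrier_vecI) simp
  have "\<nu> * (w \<bullet> w) = w \<bullet> (Y *\<^sub>v w)" using w by (simp add: Yw)
  also have "\<dots> = w \<bullet> ((u \<bullet> w) \<cdot>\<^sub>v u) - w \<bullet> (X *\<^sub>v ?y)"
    unfolding Y_mult[OF w] using w u X y by (intro scalar_prod_minus_distrib[of _ n]) auto
  also have "\<dots> = - (?y \<bullet> ?y)"
    using transpose_vec_mult_scalar[OF X y w] w u uw by simp
  finally have eq: "\<nu> * (w \<bullet> w) = - (?y \<bullet> ?y)" .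
  have ww: "0 < w \<bullet> w" by (rule scalar_prod_self_pos[OF w w0])
  show ?thesis
  proof (cases "?y = 0\<^sub>v r")
    case True
    then have "\<nu> * (w \<bullet> w) = 0" using eq by simp
    then show ?thesis using ww True by simp
  next
    case False
    then have "\<nu> * (w \<bullet> w) < 0" using eq scalar_prod_self_pos[OF y] by simp
    then show ?thesis using ww by (simp add: mult_less_0_iff)
  qed
qed

text \<open>An arbitrary eigendecomposition is fixed, because the recovery has to work for every
  choice of signs and of bases of eigenspaces.\<close>

context
  fixes v :: "nat \<Rightarrow> real vec" and l :: "nat \<Rightarrow> real"
  assumes vl: "eigendecomposition Y v l"
begin

lemmas v = eigendecomposition_carrier[OF Y vl]

lemma v_orthonormal: "j < n \<Longrightarrow> k < n \<Longrightarrow> v j \<bullet> v k = (if j = k then 1 else 0)"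
  using vl Y by (simp add: eigendecomposition_def)

lemma l_antimono: "j \<le> k \<Longrightarrow> k < n \<Longrightarrow> l k \<le> l j"
  using vl Y by (auto simp: eigendecomposition_def)

text \<open>By completeness \<open>u\<close> cannot be orthogonal to every \<open>v k\<close>.
  Removing from such a \<open>v k\<close> its projection on \<open>u\<close> leaves a vector
  orthogonal to \<open>u\<close> that satisfies the eigenvalue equation for
  \<open>u \<bullet> u > 0\<close>; on the complement of \<open>u\<close> no eigenvalue is positive,
  so the remainder is zero.\<close>

lemma top_eigenvector_aux:
  obtains k c where "k < n" "l k = u \<bullet> u" "v k = c \<cdot>\<^sub>v u" "c \<noteq> 0"
proof -
  have "\<exists>k<n. u \<bullet> v k \<noteq> 0"
  proof (rule ccontr)
    assume "\<not> ?thesis"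
    moreover have "u \<bullet> v k = (\<Sum>j<n. u $ j * v k $ j)" if "k < n" for k
      using v(1)[OF that] by (simp add: scalar_prod_def atLeast0LessThan)
    ultimately have uv: "(\<Sum>j<n. u $ j * v k $ j) = 0" if "k < n" for k
      using that by metis
    have "u = 0\<^sub>v n"
    proof (rule eq_vecI)
      fix i assume "i < dim_vec (0\<^sub>v n :: real vec)"
      then have i: "i < n" by simp
      have "u $ i = (\<Sum>j<n. if j = i then u $ j else 0)" using i by simp
      also have "\<dots> = (\<Sum>j<n. \<Sum>k<n. u $ j * v k $ j * v k $ i)"
        using eigendecomposition_complete[OF Y vl _ i]
        by (intro sum.cong) (auto simp: sum_distrib_left[symmetric] mult.assoc)
      also have "\<dots> = (\<Sum>k<n. (\<Sum>j<n. u $ j * v k $ j) * v k $ i)"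
        unfolding sum_distrib_right by (rule sum.swap)
      also have "\<dots> = 0" using uv by simp
      finally show "u $ i = 0\<^sub>v n $ i" using i by simp
    qed (use u in simp)
    then show False using u_nonzero by simp
  qed
  then obtain k where k: "k < n" and uvk: "u \<bullet> v k \<noteq> 0" by blast
  have lk: "l k = u \<bullet> u" using eigenvector_orthogonal[OF v(3)[OF k]] uvk by blast
  define c where "c = (u \<bullet> v k) / (u \<bullet> u)"
  define w where "w = v k - c \<cdot>\<^sub>v u"
  have w: "w \<in> carrier_vec n" using v(1)[OF k] u by (simp add: w_def)
  have uw: "u \<bullet> w = 0"
    using v(1)[OF k] u mu_pos by (simp add: w_def c_def scalar_prod_minus_distrib[of _ n])
  have Yw: "Y *\<^sub>v w = (u \<bullet> u) \<cdot>\<^sub>v w"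
  proof -
    have "Y *\<^sub>v w = Y *\<^sub>v v k - Y *\<^sub>v (c \<cdot>\<^sub>v u)"
      unfolding w_def using Y v(1)[OF k] u by (intro mult_minus_distrib_mat_vec[of _ n n]) auto
    also have "\<dots> = (u \<bullet> u) \<cdot>\<^sub>v v k - c \<cdot>\<^sub>v ((u \<bullet> u) \<cdot>\<^sub>v u)"
      using v(2)[OF k] lk Y u by (simp add: mult_mat_vec[of _ n n] Y_u)
    also have "\<dots> = (u \<bullet> u) \<cdot>\<^sub>v w"
      unfolding w_def using v(1)[OF k] u by (intro eq_vecI) (auto simp: algebra_simps)
    finally show ?thesis .
  qed
  have "w = 0\<^sub>v n"
    using eigenvalue_orthogonal[of w "u \<bullet> u"] uw Yw w Y mu_pos by (auto simp: eigenvector_def)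
  have "v k = c \<cdot>\<^sub>v u"
  proof (rule eq_vecI)
    fix i assume "i < dim_vec (c \<cdot>\<^sub>v u)"
    then show "v k $ i = (c \<cdot>\<^sub>v u) $ i"
      using arg_cong[OF \<open>w = 0\<^sub>v n\<close>, of "\<lambda>w. w $ i"] u v(1)[OF k] by (simp add: w_def)
  qed (use u v(1)[OF k] in simp)
  moreover have "c \<noteq> 0" using uvk mu_pos by (simp add: c_def)
  ultimately show ?thesis using that k lk by blast
qed

lemma top_eigenvector:
  shows "0 < n" and "l 0 = u \<bullet> u" and "\<exists>c. v 0 = c \<cdot>\<^sub>v u"
    and "\<And>j. 0 < j \<Longrightarrow> j < n \<Longrightarrow> u \<bullet> v j = 0" and "\<And>j. 0 < j \<Longrightarrow> j < n \<Longrightarrow> l j \<le> 0"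
proof -
  obtain k c where k: "k < n" "l k = u \<bullet> u" and vk: "v k = c \<cdot>\<^sub>v u" "c \<noteq> 0"
    by (rule top_eigenvector_aux)
  have orth: "u \<bullet> v j = 0" if "j < n" "j \<noteq> k" for j
    using v_orthonormal[of k j] that k vk v(1)[of j] u by simp
  have le: "l j \<le> 0" if "j < n" "j \<noteq> k" for j
    using eigenvalue_orthogonal[OF v(3)[OF that(1)] orth[OF that]] by auto
  \<comment> \<open>Otherwise \<open>l 0 \<le> 0 < l k\<close>, against the decreasing
    order.\<close>
  have k0: "k = 0"
    using le[of 0] l_antimono[of 0 k] k mu_pos by fastforce
  show "0 < n" "l 0 = u \<bullet> u" "\<exists>c. v 0 = c \<cdot>\<^sub>v u" using k vk k0 by auto
  show "u \<bullet> v j = 0" if "0 < j" "j < n" for j using orth[OF that(2)] that k0 by simp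
  show "l j \<le> 0" if "0 < j" "j < n" for j using le[OF that(2)] that k0 by simp
qed

text \<open>\<open>v 0\<close> is a unit vector on the line of \<open>u\<close>, and
  \<open>sqrt (l 0)\<close> is the norm of \<open>u\<close>; only the sign remains free.\<close>

lemma u_eq_eig_time: "u = eig_time v l \<or> u = - eig_time v l"
proof -
  obtain c where c: "v 0 = c \<cdot>\<^sub>v u" using top_eigenvector(3) by blast
  have "c * c * (u \<bullet> u) = 1"
    using v_orthonormal[of 0 0] top_eigenvector(1) u by (simp add: c)
  then have "(sqrt (l 0) * c)\<^sup>2 = 1"
    using mu_pos by (simp add: top_eigenvector(2) power2_eq_square power_mult_distrib algebra_simps)
  then have "sqrt (l 0) * c = 1 \<or> sqrt (l 0) * c = - 1" by (simp add: power2_eq_1_iff)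
  then show ?thesis
    by (auto simp: eig_time_def c smult_smult_assoc)
qed

lemma u_mult_u:
  assumes "i < n" and "j < n"
  shows "u $ i * u $ j = l 0 * v 0 $ i * v 0 $ j"
proof -
  have "v 0 \<in> carrier_vec n" using v(1) top_eigenvector(1) by simp
  moreover have "sqrt (l 0) * sqrt (l 0) = l 0"
    using mu_pos by (simp add: top_eigenvector(2))
  moreover have "(s * a) * (s * b) = (s * s) * a * b" for s a b :: real
    by (simp only: ac_simps)
  ultimately have "eig_time v l $ i * eig_time v l $ j = l 0 * v 0 $ i * v 0 $ j"
    using assms by (simp only: eig_time_def carrier_vecD index_smult_vec)
  moreover have "dim_vec (eig_time v l) = n" using \<open>v 0 \<in> carrier_vec n\<close> by (simp add: eig_time_def)
  ultimately show ?thesis using u_eq_eig_time assms by auto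
qed

text \<open>For a negative eigenvalue \<open>l k\<close> the vectors \<open>X\<^sup>T v\<^sub>j / sqrt (- l j)\<close>, \<open>k \<le> j\<close>, are
  orthonormal in dimension \<open>r\<close>.\<close>

lemma eigenvalue_zero:
  assumes k: "0 < k" "k + r < n"
  shows "l k = 0"
proof (rule ccontr)
  assume "l k \<noteq> 0"
  then have "l k < 0" using top_eigenvector(5)[of k] k by simp
  then have neg: "l (k + j) < 0" if "k + j < n" for j using l_antimono[of k "k + j"] that by simp
  define f where "f j = (1 / sqrt (- l (k + j))) \<cdot>\<^sub>v (transpose_mat X *\<^sub>v v (k + j))" for j
  have "f i \<bullet> f j = (if i = j then 1 else 0)" if "i < n - k" "j < n - k" for i j
  proof -
    have i: "k + i < n" and j: "k + j < n" using that by auto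
    let ?y = "\<lambda>j. transpose_mat X *\<^sub>v v (k + j)"
    have y: "?y j \<in> carrier_vec r" for j using X by (intro carrier_vecI) simp
    have uvj: "u \<bullet> v (k + j) = 0" using top_eigenvector(4)[of "k + j"] k j by simp
    have "?y i \<bullet> ?y j = v (k + i) \<bullet> (X *\<^sub>v ?y j)"
      by (rule transpose_vec_mult_scalar[OF X y v(1)[OF i]])
    moreover have "v (k + i) \<bullet> (Y *\<^sub>v v (k + j)) = v (k + i) \<bullet> ((u \<bullet> v (k + j)) \<cdot>\<^sub>v u) - v (k + i) \<bullet> (X *\<^sub>v ?y j)"
      unfolding Y_mult[OF v(1)[OF j]] using v(1)[OF i] u X y
      by (intro scalar_prod_minus_distrib[of _ n]) auto
    moreover have "v (k + i) \<bullet> (Y *\<^sub>v v (k + j)) = (if i = j then l (k + j) else 0)"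
      using v(1)[OF i] v(1)[OF j] v_orthonormal[OF i j] by (simp add: v(2)[OF j])
    ultimately have "?y i \<bullet> ?y j = (if i = j then - l (k + j) else 0)"
      using uvj u v(1)[OF i] by (auto split: if_splits)
    then show ?thesis
      using neg[OF j] by (simp add: f_def)
  qed
  then have "n - k \<le> r"
    using X by (intro orthonormal_length_le[of "n - k" f r]) (auto simp: f_def intro!: carrier_vecI)
  then show False using k by simp
qed

text \<open>Adding the term of index 0, which is \<open>u u^T\<close>, to the non-positive part
  completes the spectral expansion of \<open>Y\<close>. The \<open>r\<close> columns of
  \<open>eig_spatial\<close> account for all of that part.\<close>

lemma eig_spatial_gram:
  "eig_spatial r n v l * transpose_mat (eig_spatial r n v l) = X * transpose_mat X"
proof (rule eq_matI)
  fix i j assume "i < dim_row (X * transpose_mat X)" "j < dim_col (X * transpose_mat X)"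
  then have ij: "i < n" "j < n" using X by auto
  define g where "g m = - l m * v m $ i * v m $ j" for m
  have "(eig_spatial r n v l * transpose_mat (eig_spatial r n v l)) $$ (i, j)
      = (\<Sum>k<r. if k + 1 < n then g (n - 1 - k) else 0)"
  proof -
    \<comment> \<open>Since \<open>k + 1 < n\<close>, the index \<open>n - 1 - k\<close> is
      positive, so the number under the root is nonnegative.\<close>
    have sq: "sqrt (- l (n - 1 - k)) * sqrt (- l (n - 1 - k)) = - l (n - 1 - k)" if "k + 1 < n" for k
      using top_eigenvector(5)[of "n - 1 - k"] that by simp
    have ac: "s * a * (s * b) = (s * s) * a * b" for s a b :: real
      by (simp only: ac_simps)
    have "sqrt (- l (n - 1 - k)) * a * (sqrt (- l (n - 1 - k)) * b) = - l (n - 1 - k) * a * b"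
      if "k + 1 < n" for k a b
      by (subst ac) (simp only: sq[OF that])
    then show ?thesis
      using ij by (auto simp: eig_spatial_def scalar_prod_def atLeast0LessThan g_def intro!: sum.cong)
  qed
  also have "\<dots> = (\<Sum>k\<in>{k. k < r \<and> k + 1 < n}. g (n - 1 - k))"
    by (rule sum.mono_neutral_cong_right) auto
  also have "\<dots> = (\<Sum>m\<in>{m. 0 < m \<and> m < n \<and> n - 1 - m < r}. g m)"
    by (rule sum.reindex_bij_witness[where i = "\<lambda>m. n - 1 - m" and j = "\<lambda>m. n - 1 - m"]) auto
  \<comment> \<open>The indices added here satisfy \<open>m + r < n\<close>, where the eigenvalue is
    zero.\<close>
  also have "\<dots> = (\<Sum>m\<in>{1..<n}. g m)"
    by (rule sum.mono_neutral_left) (auto simp: g_def intro!: eigenvalue_zero)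
  also have "\<dots> = u $ i * u $ j - (\<Sum>m<n. l m * v m $ i * v m $ j)"
  proof -
    have "{..<n} = insert 0 {1..<n}" using top_eigenvector(1) by auto
    then show ?thesis
      using u_mult_u[OF ij] by (simp add: g_def sum_negf)
  qed
  also have "\<dots> = u $ i * u $ j - Y $$ (i, j)" by (simp add: eigendecomposition_entry[OF Y vl ij])
  also have "\<dots> = (X * transpose_mat X) $$ (i, j)" using ij X u by (simp add: Y_eq outer_def)
  finally show "(eig_spatial r n v l * transpose_mat (eig_spatial r n v l)) $$ (i, j)
    = (X * transpose_mat X) $$ (i, j)" .
qed (use X in \<open>auto simp: eig_spatial_def\<close>)

end

text \<open>Accounts for multiplicities, which a statement about single eigenvectors does not: the
  positive root \<open>u \<bullet> u\<close> is simple.\<close>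

lemma char_poly_Y:
  "\<exists>es. char_poly Y = [:- (u \<bullet> u), 1:] * (\<Prod>e\<leftarrow>es. [:- e, 1:]) \<and> (\<forall>e \<in> set es. e \<le> 0)"
proof -
  obtain v l where vl: "eigendecomposition Y v l"
    using eigendecomposition_exists[OF Y Y_sym] by blast
  note top = top_eigenvector[OF vl]
  have "[0..<n] = 0 # [1..<n]" using top(1) by (simp add: upt_conv_Cons)
  then have "char_poly Y = [:- (u \<bullet> u), 1:] * (\<Prod>e\<leftarrow>map l [1..<n]. [:- e, 1:])"
    using eigendecomposition_char_poly[OF Y vl] top(2) by simp
  moreover have "\<forall>e \<in> set (map l [1..<n]). e \<le> 0" using top(5) by auto
  ultimately show ?thesis by blast
qed

lemma factor_unique:
  assumes Xh: "Xh \<in> carrier_mat n r" and eq: "Y = outer u - Xh * transpose_mat Xh"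
  shows "\<exists>R \<in> orthogonal_group r. Xh = X * R"
proof (rule equal_gram_mat_imp_orthogonal[OF X Xh], rule eq_matI)
  fix i j assume "i < dim_row (Xh * transpose_mat Xh)" "j < dim_col (Xh * transpose_mat Xh)"
  then have ij: "i < n" "j < n" using Xh by auto
  have "outer u - X * transpose_mat X = outer u - Xh * transpose_mat Xh"
    using eq Y_eq by simp
  from arg_cong[OF this, of "\<lambda>M. M $$ (i, j)"]
  show "(X * transpose_mat X) $$ (i, j) = (Xh * transpose_mat Xh) $$ (i, j)"
    using ij X Xh u by (simp add: outer_def)
qed (use X Xh in auto)

section \<open>PCA of \<open>- Y\<close> as an eigendecomposition of \<open>Y\<close> read
  backwards\<close>

lemma eigendecomposition_uminus_reverse:
  assumes "eigendecomposition (- Y) v l"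
  shows "eigendecomposition Y (\<lambda>k. v (n - 1 - k)) (\<lambda>k. - l (n - 1 - k))"
proof -
  have ev: "eigenvector Y w (- \<nu>)" if "eigenvector (- Y) w \<nu>" for w \<nu>
  proof -
    have w: "w \<in> carrier_vec n" "w \<noteq> 0\<^sub>v n" and neg: "- (Y *\<^sub>v w) = \<nu> \<cdot>\<^sub>v w"
      using that Y by (auto simp: eigenvector_def)
    have "Y *\<^sub>v w = - \<nu> \<cdot>\<^sub>v w"
    proof (rule eq_vecI)
      fix i assume "i < dim_vec (- \<nu> \<cdot>\<^sub>v w)"
      then show "(Y *\<^sub>v w) $ i = (- \<nu> \<cdot>\<^sub>v w) $ i"
        using arg_cong[OF neg, of "\<lambda>w. w $ i"] w Y by simp
    qed (use w Y in simp)
    then show ?thesis using w Y by (simp add: eigenvector_def)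
  qed
  have "eigenvector Y (v (n - 1 - k)) (- l (n - 1 - k))" if "k < n" for k
    using assms Y that by (intro ev) (simp add: eigendecomposition_def)
  moreover have "v (n - 1 - j) \<bullet> v (n - 1 - k) = (if j = k then 1 else 0)" if "j < n" "k < n" for j k
    using assms Y that by (auto simp: eigendecomposition_def)
  moreover have "- l (n - 1 - k) \<le> - l (n - 1 - j)" if "j \<le> k" "k < n" for j k
    using assms Y that by (auto simp: eigendecomposition_def)
  ultimately show ?thesis using Y by (simp add: eigendecomposition_def)
qed

text \<open>After reversal the two column rules could differ only at \<open>k = n - 1\<close>, the
  place of the eigenvector along \<open>u\<close>. There \<open>- Y\<close> has the eigenvalue
  \<open>- (u \<bullet> u) < 0\<close>, so the sign test of \<open>pca\<close> drops the column just
  as the bound \<open>k + 1 < n\<close> does.\<close>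

lemma pca_eq_eig_spatial:
  assumes "pca r (- Y) Xh"
  obtains v l where "eigendecomposition Y v l" "Xh = eig_spatial r n v l"
proof -
  obtain v l where vl: "eigendecomposition (- Y) v l"
    and Xh: "Xh = mat n r (\<lambda>(i, k). if k < n \<and> l k \<ge> 0 then sqrt (l k) * v k $ i else 0)"
    using assms Y by (auto simp: pca_def)
  note vl' = eigendecomposition_uminus_reverse[OF vl]
  note top = top_eigenvector[OF vl']
  have "Xh = eig_spatial r n (\<lambda>k. v (n - 1 - k)) (\<lambda>k. - l (n - 1 - k))"
  proof (rule eq_matI)
    fix i k assume "i < dim_row (eig_spatial r n (\<lambda>k. v (n - 1 - k)) (\<lambda>k. - l (n - 1 - k)))"
      "k < dim_col (eig_spatial r n (\<lambda>k. v (n - 1 - k)) (\<lambda>k. - l (n - 1 - k)))"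
    then have ik: "i < n" "k < r" by (auto simp: eig_spatial_def)
    consider "k + 1 < n" | "k + 1 = n" | "n \<le> k" by linarith
    then show "Xh $$ (i, k) = eig_spatial r n (\<lambda>k. v (n - 1 - k)) (\<lambda>k. - l (n - 1 - k)) $$ (i, k)"
    proof cases
      case 1
      then have "l k \<ge> 0" and "n - 1 - (n - 1 - k) = k" using top(5)[of "n - 1 - k"] by auto
      then show ?thesis using ik 1 by (simp add: Xh eig_spatial_def)
    next
      case 2
      then have "l k < 0" using top(2) mu_pos by auto
      then show ?thesis using ik 2 by (simp add: Xh eig_spatial_def)
    next
      case 3
      then show ?thesis using ik by (simp add: Xh eig_spatial_def)
    qed
  qed (auto simp: Xh eig_spatial_def)
  then show ?thesis using that vl' by blast
qed

lemma pca_exists: "\<exists>Xh. pca r (- Y) Xh"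
proof -
  have "transpose_mat (- Y) = - Y" using Y Y_sym by (simp add: transpose_uminus)
  then obtain v l where "eigendecomposition (- Y) v l"
    using eigendecomposition_exists[of "- Y" n] Y by auto
  then show ?thesis by (auto simp: pca_def)
qed

end

section \<open>The hyperboloid and pseudo-Euclidean means\<close>

lemma Q_form_eq:
  assumes "x \<in> carrier_vec (Suc r)" and "y \<in> carrier_vec (Suc r)"
  shows "Q_form r x y = x $ 0 * y $ 0 - (\<Sum>k<r. x $ Suc k * y $ Suc k)"
proof -
  have "(Q_mat r *\<^sub>v y) $ i = (if i = 0 then y $ 0 else - y $ i)" if "i < Suc r" for i
  proof -
    have "(Q_mat r *\<^sub>v y) $ i
        = (\<Sum>j\<in>{0..<Suc r}. (if i = j then if i = 0 then 1 else - 1 else 0) * y $ j)"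
      using that assms by (simp add: Q_mat_def scalar_prod_def)
    also have "\<dots> = (\<Sum>j\<in>{0..<Suc r}. if i = j then if i = 0 then y $ 0 else - y $ i else 0)"
      by (rule sum.cong) auto
    also have "\<dots> = (if i = 0 then y $ 0 else - y $ i)"
      using that by simp
    finally show ?thesis .
  qed
  then have "Q_form r x y = (\<Sum>i\<in>{0..<Suc r}. x $ i * (if i = 0 then y $ 0 else - y $ i))"
    by (simp add: Q_form_def scalar_prod_def Q_mat_def)
  also have "\<dots> = x $ 0 * y $ 0 + (\<Sum>k\<in>{0..<r}. x $ Suc k * - y $ Suc k)"
    by (simp add: sum.atLeast0_lessThan_Suc_shift del: sum.op_ivl_Suc)
  finally show ?thesis by (simp add: sum_negf atLeast0LessThan)
qed

lemma Q_form_commute: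
  assumes "x \<in> carrier_vec (Suc r)" and "y \<in> carrier_vec (Suc r)"
  shows "Q_form r x y = Q_form r y x"
  using assms by (simp add: Q_form_eq mult.commute)

lemma Q_form_add_left:
  assumes "x \<in> carrier_vec (Suc r)" and "y \<in> carrier_vec (Suc r)" and "z \<in> carrier_vec (Suc r)"
  shows "Q_form r (x + y) z = Q_form r x z + Q_form r y z"
  using assms by (simp add: Q_form_eq sum.distrib algebra_simps)

lemma Q_form_diff_left:
  assumes "x \<in> carrier_vec (Suc r)" and "y \<in> carrier_vec (Suc r)" and "z \<in> carrier_vec (Suc r)"
  shows "Q_form r (x - y) z = Q_form r x z - Q_form r y z"
  using assms by (simp add: Q_form_eq sum.distrib sum_subtractf algebra_simps)

lemma Q_form_smult_left:
  assumes "x \<in> carrier_vec (Suc r)" and "z \<in> carrier_vec (Suc r)"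
  shows "Q_form r (c \<cdot>\<^sub>v x) z = c * Q_form r x z"
  using assms by (simp add: Q_form_eq sum_distrib_left algebra_simps)

lemma Q_form_add_right:
  assumes "x \<in> carrier_vec (Suc r)" and "y \<in> carrier_vec (Suc r)" and "z \<in> carrier_vec (Suc r)"
  shows "Q_form r z (x + y) = Q_form r z x + Q_form r z y"
  using assms by (simp add: Q_form_eq sum.distrib algebra_simps)

lemma Q_form_diff_right:
  assumes "x \<in> carrier_vec (Suc r)" and "y \<in> carrier_vec (Suc r)" and "z \<in> carrier_vec (Suc r)"
  shows "Q_form r z (x - y) = Q_form r z x - Q_form r z y"
  using assms by (simp add: Q_form_eq sum.distrib sum_subtractf algebra_simps)

lemma Q_form_smult_right:
  assumes "x \<in> carrier_vec (Suc r)" and "z \<in> carrier_vec (Suc r)"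
  shows "Q_form r z (c \<cdot>\<^sub>v x) = c * Q_form r z x"
  using assms by (simp add: Q_form_eq sum_distrib_left algebra_simps)

lemma Q_form_origin_right:
  assumes "x \<in> carrier_vec (Suc r)"
  shows "Q_form r x (hyp_origin r) = x $ 0"
  using assms by (simp add: Q_form_eq hyp_origin_def)

lemma Q_form_unit_right:
  assumes "x \<in> carrier_vec (Suc r)" and "k < r"
  shows "Q_form r x (unit_vec (Suc r) (Suc k)) = - x $ Suc k"
proof -
  have "(\<Sum>j<r. x $ Suc j * (unit_vec (Suc r) (Suc k) :: real vec) $ Suc j) = (\<Sum>j<r. if j = k then x $ Suc k else 0)"
    by (rule sum.cong) (use assms in \<open>auto simp: unit_vec_def\<close>)
  then show ?thesis using assms by (simp add: Q_form_eq)
qed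

lemma hyperboloid_carrier: "x \<in> hyperboloid r \<Longrightarrow> x \<in> carrier_vec (Suc r)"
  by (simp add: hyperboloid_def)

lemma hyperboloid_time_sq:
  assumes "x \<in> hyperboloid r"
  shows "(x $ 0)\<^sup>2 = 1 + (\<Sum>k<r. (x $ Suc k)\<^sup>2)"
  using assms by (auto simp: hyperboloid_def Q_form_eq power2_eq_square)

lemma hyperboloid_time_ge_1:
  assumes "x \<in> hyperboloid r"
  shows "1 \<le> x $ 0"
proof -
  have "0 \<le> (\<Sum>k<r. (x $ Suc k)\<^sup>2)" by (simp add: sum_nonneg)
  then have "1\<^sup>2 \<le> (x $ 0)\<^sup>2" using hyperboloid_time_sq[OF assms] by simp
  moreover have "0 \<le> x $ 0" using assms by (simp add: hyperboloid_def)
  ultimately show ?thesis by (rule power2_le_imp_le)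
qed

lemma hyp_origin_mem: "hyp_origin r \<in> hyperboloid r"
  by (simp add: hyperboloid_def hyp_origin_def Q_form_eq)

text \<open>Expanding \<open>0 \<le> \<parallel>y\<^sub>0 p - x\<^sub>0 q\<parallel>\<^sup>2\<close> for the spatial parts \<open>p, q\<close> of \<open>x, y\<close> bounds \<open>p \<bullet> q\<close>.\<close>

lemma Q_form_ge_1:
  assumes x: "x \<in> hyperboloid r" and y: "y \<in> hyperboloid r"
  shows "1 \<le> Q_form r x y"
proof -
  let ?s = "x $ 0" and ?t = "y $ 0" and ?pq = "\<Sum>k<r. x $ Suc k * y $ Suc k"
  have pos: "?s > 0" "?t > 0" using x y by (auto simp: hyperboloid_def)
  have "0 \<le> (\<Sum>k<r. (?t * x $ Suc k - ?s * y $ Suc k)\<^sup>2)" by (simp add: sum_nonneg)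
  also have "\<dots> = (\<Sum>k<r. ?t\<^sup>2 * (x $ Suc k)\<^sup>2 + ?s\<^sup>2 * (y $ Suc k)\<^sup>2 - 2 * (?s * ?t) * (x $ Suc k * y $ Suc k))"
    by (rule sum.cong) (auto simp: power2_eq_square algebra_simps)
  also have "\<dots> = ?t\<^sup>2 * (\<Sum>k<r. (x $ Suc k)\<^sup>2) + ?s\<^sup>2 * (\<Sum>k<r. (y $ Suc k)\<^sup>2) - 2 * (?s * ?t) * ?pq"
    by (simp only: sum.distrib sum_subtractf sum_distrib_left)
  also have "\<dots> = 2 * ?s\<^sup>2 * ?t\<^sup>2 - ?s\<^sup>2 - ?t\<^sup>2 - 2 * (?s * ?t) * ?pq"
    using hyperboloid_time_sq[OF x] hyperboloid_time_sq[OF y] by (simp add: algebra_simps)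
  also have "\<dots> = 2 * (?s * ?t) * (?s * ?t - ?pq - 1) - (?s - ?t)\<^sup>2"
    by (simp add: power2_eq_square algebra_simps)
  finally have "0 \<le> 2 * (?s * ?t) * (?s * ?t - ?pq - 1)"
    using zero_le_power2[of "?s - ?t"] by linarith
  moreover have "2 * (?s * ?t) > 0" using pos by simp
  ultimately have "0 \<le> ?s * ?t - ?pq - 1" by (simp only: zero_le_mult_iff) linarith
  then show ?thesis using x y by (simp add: Q_form_eq hyperboloid_carrier)
qed

lemma cosh_hyp_dist:
  assumes "x \<in> hyperboloid r" and "y \<in> hyperboloid r"
  shows "cosh (hyp_dist r x y) = Q_form r x y"
  using Q_form_ge_1[OF assms] by (simp add: hyp_dist_def)

section \<open>The quadratic form behind \<open>Psi\<close> and the criterion for centering\<close>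

lemma Psi_eq:
  assumes "\<forall>i<n. x i \<in> hyperboloid r" and "z \<in> hyperboloid r"
  shows "Psi r n x z = (\<Sum>i<n. (Q_form r (x i) z)\<^sup>2) - real n"
proof -
  have "(sinh (hyp_dist r (x i) z))\<^sup>2 = (Q_form r (x i) z)\<^sup>2 - 1" if "i < n" for i
    using cosh_hyp_dist[of "x i" r z] assms that cosh_square_eq[of "hyp_dist r (x i) z"] by simp
  then show ?thesis by (simp add: Psi_def sum_subtractf)
qed

lemma spatial_time_eq:
  "transpose_mat (spatial_mat r n x) *\<^sub>v time_vec n x = vec r (\<lambda>k. \<Sum>i<n. x i $ 0 * x i $ Suc k)"
  by (rule eq_vecI)
    (auto simp: spatial_mat_def time_vec_def scalar_prod_def atLeast0LessThan mult.commute intro!: sum.cong)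

lemma spatial_time_eq_0_iff:
  "transpose_mat (spatial_mat r n x) *\<^sub>v time_vec n x = 0\<^sub>v r
    \<longleftrightarrow> (\<forall>k<r. (\<Sum>i<n. x i $ 0 * x i $ Suc k) = 0)"
  unfolding spatial_time_eq by (auto simp: vec_eq_iff)

text \<open>Separates the mixed term, whose coefficients are the entries of \<open>X^T u\<close>,
  from two terms that are nonnegative.\<close>

lemma sum_Q_form_sq:
  assumes "\<forall>i<n. x i \<in> carrier_vec (Suc r)" and "z \<in> carrier_vec (Suc r)"
  shows "(\<Sum>i<n. (Q_form r (x i) z)\<^sup>2) = (z $ 0)\<^sup>2 * (\<Sum>i<n. (x i $ 0)\<^sup>2)
    - 2 * z $ 0 * (\<Sum>k<r. (\<Sum>i<n. x i $ 0 * x i $ Suc k) * z $ Suc k)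
    + (\<Sum>i<n. (\<Sum>k<r. x i $ Suc k * z $ Suc k)\<^sup>2)"
proof -
  have "(\<Sum>k<r. (\<Sum>i<n. x i $ 0 * x i $ Suc k) * z $ Suc k)
      = (\<Sum>i<n. x i $ 0 * (\<Sum>k<r. x i $ Suc k * z $ Suc k))"
    unfolding sum_distrib_left sum_distrib_right by (subst sum.swap) (simp add: mult.assoc)
  moreover have "(Q_form r (x i) z)\<^sup>2 = (z $ 0)\<^sup>2 * (x i $ 0)\<^sup>2
      - 2 * z $ 0 * (x i $ 0 * (\<Sum>k<r. x i $ Suc k * z $ Suc k))
      + (\<Sum>k<r. x i $ Suc k * z $ Suc k)\<^sup>2" if "i < n" for i
    using assms that by (simp add: Q_form_eq power2_eq_square algebra_simps)
  ultimately show ?thesis by (simp add: sum.distrib sum_subtractf sum_distrib_left)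
qed

text \<open>If \<open>b = X^T u\<close> is nonzero, \<open>Psi\<close> has slope
  \<open>- 2 * sqrt B\<close> at the origin along the geodesic in direction \<open>b\<close>. If
  \<open>b = 0\<close>, the mixed term is gone and the time coordinate is at least 1, which makes
  the origin even a global minimum.\<close>

lemma pe_centered_iff:
  assumes x: "\<forall>i<n. x i \<in> hyperboloid r"
  shows "pe_centered r n x \<longleftrightarrow> transpose_mat (spatial_mat r n x) *\<^sub>v time_vec n x = 0\<^sub>v r"
proof -
  define A where "A = (\<Sum>i<n. (x i $ 0)\<^sup>2)"
  define b where "b k = (\<Sum>i<n. x i $ 0 * x i $ Suc k)" for k
  have A: "A \<ge> 0" by (simp add: A_def sum_nonneg)
  have Psi_z: "Psi r n x z = (z $ 0)\<^sup>2 * A - 2 * z $ 0 * (\<Sum>k<r. b k * z $ Suc k)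
    + (\<Sum>i<n. (\<Sum>k<r. x i $ Suc k * z $ Suc k)\<^sup>2) - n" if "z \<in> hyperboloid r" for z
    using sum_Q_form_sq[of n x r z] Psi_eq[OF x that] x that by (simp add: hyperboloid_carrier A_def b_def)
  have Psi_o: "Psi r n x (hyp_origin r) = A - n"
    using Psi_z[OF hyp_origin_mem] by (simp add: hyp_origin_def)
  have "(\<forall>k<r. b k = 0)" if pc: "pe_centered r n x"
  proof -
    obtain \<epsilon> where eps: "\<epsilon> > 0"
      and min: "\<And>w. w \<in> hyperboloid r \<Longrightarrow> hyp_dist r (hyp_origin r) w < \<epsilon> \<Longrightarrow> A - n \<le> Psi r n x w"
      using pc Psi_o by (auto simp: pe_centered_def pe_mean_def)
    define B where "B = (\<Sum>k<r. (b k)\<^sup>2)"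
    define S where "S = (\<Sum>i<n. (\<Sum>k<r. x i $ Suc k * b k)\<^sup>2)"
    have B: "B \<ge> 0" and S: "S \<ge> 0" by (auto simp: B_def S_def intro: sum_nonneg)
    have "\<not> B > 0"
    proof
      assume B0: "B > 0"
      \<comment> \<open>The geodesic from the origin in the direction \<open>b\<close>, which is minus half the gradient of \<open>\<Psi>\<close>.\<close>
      define z where "z t = vec (Suc r) (\<lambda>k. if k = 0 then cosh t else sinh t / sqrt B * b (k - 1))" for t
      have z0: "z t $ 0 = cosh t" and zk: "k < r \<Longrightarrow> z t $ Suc k = sinh t / sqrt B * b k" for t k
        by (auto simp: z_def)
      have zc: "z t \<in> carrier_vec (Suc r)" for t by (simp add: z_def)
      have zz: "(\<Sum>k<r. z t $ Suc k * z t $ Suc k) = (sinh t)\<^sup>2" for t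
      proof -
        have "(\<Sum>k<r. z t $ Suc k * z t $ Suc k) = (\<Sum>k<r. (sinh t)\<^sup>2 / B * (b k)\<^sup>2)"
          using B0 by (intro sum.cong) (auto simp: zk power2_eq_square)
        also have "\<dots> = (sinh t)\<^sup>2 / B * B" by (simp only: sum_distrib_left[symmetric] B_def[symmetric])
        also have "\<dots> = (sinh t)\<^sup>2" using B0 by simp
        finally show ?thesis .
      qed
      have zh: "z t \<in> hyperboloid r" for t
        using zc[of t] zz[of t] by (simp add: hyperboloid_def Q_form_eq z0 cosh_square_eq power2_eq_square[symmetric])
      have dist: "hyp_dist r (hyp_origin r) (z t) = t" if "t \<ge> 0" for t
      proof -
        have "Q_form r (hyp_origin r) (z t) = cosh t"
          using Q_form_commute[OF zc hyperboloid_carrier[OF hyp_origin_mem], of t]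
            Q_form_origin_right[OF zc, of t] z0[of t] by metis
        then show ?thesis using that by (simp add: hyp_dist_def arcosh_cosh_real)
      qed
      have Psi_t: "Psi r n x (z t) = (cosh t)\<^sup>2 * A - 2 * cosh t * (sinh t * sqrt B) + (sinh t)\<^sup>2 * (S / B) - n" for t
      proof -
        have "(\<Sum>k<r. b k * z t $ Suc k) = (\<Sum>k<r. sinh t / sqrt B * (b k)\<^sup>2)"
          by (intro sum.cong) (auto simp: zk power2_eq_square)
        also have "\<dots> = sinh t / sqrt B * B" by (simp only: sum_distrib_left[symmetric] B_def[symmetric])
        also have "\<dots> = sinh t * sqrt B" using B0 by (simp add: field_simps)
        finally have 1: "(\<Sum>k<r. b k * z t $ Suc k) = sinh t * sqrt B" .
        have lin: "(\<Sum>k<r. x i $ Suc k * z t $ Suc k) = sinh t / sqrt B * (\<Sum>k<r. x i $ Suc k * b k)" for i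
          unfolding sum_distrib_left by (intro sum.cong) (auto simp: zk)
        have "(\<Sum>k<r. x i $ Suc k * z t $ Suc k)\<^sup>2 = (sinh t)\<^sup>2 / B * (\<Sum>k<r. x i $ Suc k * b k)\<^sup>2" for i
          by (simp only: lin power_mult_distrib power_divide real_sqrt_pow2[OF B])
        then have 2: "(\<Sum>i<n. (\<Sum>k<r. x i $ Suc k * z t $ Suc k)\<^sup>2) = (sinh t)\<^sup>2 * (S / B)"
          by (simp add: S_def sum_divide_distrib[symmetric] sum_distrib_left[symmetric])
        show ?thesis using Psi_z[OF zh, of t] unfolding 1 2 z0 by simp
      qed
      \<comment> \<open>Minimality with \<open>cosh^2 = sinh^2 + 1\<close>: the constant
        \<open>A\<close> cancels, one positive factor \<open>sinh t\<close> is divided out, and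
        \<open>cosh t \<ge> 1\<close> simplifies the rest.\<close>
      have key: "2 * sqrt B \<le> sinh t * (A + S / B)" if t: "0 < t" "t < \<epsilon>" for t
      proof -
        have st: "sinh t > 0" using t by simp
        have "A \<le> (cosh t)\<^sup>2 * A - 2 * cosh t * (sinh t * sqrt B) + (sinh t)\<^sup>2 * (S / B)"
          using min[OF zh, of t] dist[of t] t Psi_t[of t] by linarith
        also have "\<dots> = A + sinh t * (sinh t * (A + S / B) - 2 * cosh t * sqrt B)"
        proof -
          have "(s\<^sup>2 + 1) * A - 2 * c * (s * d) + s\<^sup>2 * m = A + s * (s * (A + m) - 2 * c * d)" for s c d m :: real
            by (simp add: power2_eq_square algebra_simps)
          then show ?thesis by (simp only: cosh_square_eq)
        qed
        finally have "0 \<le> sinh t * (sinh t * (A + S / B) - 2 * cosh t * sqrt B)" by linarith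
        then have "2 * cosh t * sqrt B \<le> sinh t * (A + S / B)"
          using st by (simp only: zero_le_mult_iff) linarith
        moreover have "1 * sqrt B \<le> cosh t * sqrt B"
          using cosh_real_ge_1[of t] B by (intro mult_right_mono) auto
        ultimately show ?thesis by linarith
      qed
      \<comment> \<open>Letting \<open>t\<close> tend to 0 from the right turns \<open>key\<close>
        into \<open>2 * sqrt B \<le> 0\<close>.\<close>
      have lim: "((\<lambda>t. sinh t * (A + S / B)) \<longlongrightarrow> sinh 0 * (A + S / B)) (at_right 0)"
        by (intro tendsto_intros)
      have "2 * sqrt B \<le> sinh 0 * (A + S / B)"
        using eventually_mono[OF eventually_at_right_real[OF eps], of "\<lambda>t. 2 * sqrt B \<le> sinh t * (A + S / B)"] key
        by (intro tendsto_lowerbound[OF lim]) auto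
      then show False using B0 by simp
    qed
    then have "B = 0" using B by simp
    then show ?thesis by (auto simp: B_def sum_nonneg_eq_0_iff)
  qed
  moreover have "pe_centered r n x" if b: "\<forall>k<r. b k = 0"
  proof -
    have "Psi r n x (hyp_origin r) \<le> Psi r n x w" if w: "w \<in> hyperboloid r" for w
    proof -
      have "1\<^sup>2 \<le> (w $ 0)\<^sup>2" using hyperboloid_time_ge_1[OF w] by (intro power_mono) auto
      then have "1 * A \<le> (w $ 0)\<^sup>2 * A" using A by (intro mult_right_mono) auto
      moreover have "0 \<le> (\<Sum>i<n. (\<Sum>k<r. x i $ Suc k * w $ Suc k)\<^sup>2)" by (simp add: sum_nonneg)
      ultimately show ?thesis using b by (simp add: Psi_z[OF w] Psi_o)
    qed
    then show ?thesis
      using hyp_origin_mem by (auto simp: pe_centered_def pe_mean_def intro: exI[of _ 1])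
  qed
  ultimately show ?thesis unfolding spatial_time_eq_0_iff b_def by blast
qed

section \<open>Half-turns and the transport of means by isometries\<close>

text \<open>The half-turn about the midpoint of \<open>z\<close> and the origin, which swaps these two points.\<close>

definition half_turn :: "nat \<Rightarrow> real vec \<Rightarrow> real vec \<Rightarrow> real vec" where
  "half_turn r z x = (Q_form r x (z + hyp_origin r) / (1 + z $ 0)) \<cdot>\<^sub>v (z + hyp_origin r) - x"

context
  fixes r :: nat and z :: "real vec"
  assumes z: "z \<in> hyperboloid r"
begin

lemma half_turn_carrier: "x \<in> carrier_vec (Suc r) \<Longrightarrow> half_turn r z x \<in> carrier_vec (Suc r)"
  by (intro carrier_vecI) (simp add: half_turn_def)

text \<open>For \<open>m = z + hyp_origin r\<close> these values show that the coefficient in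
  \<open>half_turn\<close> is \<open>2 Q(x, m) / Q(m, m)\<close>: the map fixes \<open>m\<close> and
  is minus the identity on its \<open>Q\<close>-orthogonal complement.\<close>

lemma half_turn_center:
  "z + hyp_origin r \<in> carrier_vec (Suc r)" "1 + z $ 0 > 0"
  "Q_form r (z + hyp_origin r) (z + hyp_origin r) = 2 * (1 + z $ 0)"
  "Q_form r z (z + hyp_origin r) = 1 + z $ 0"
proof -
  note c = hyperboloid_carrier[OF z] and oc = hyperboloid_carrier[OF hyp_origin_mem[of r]]
  show m: "z + hyp_origin r \<in> carrier_vec (Suc r)" using c oc by simp
  show "1 + z $ 0 > 0" using z by (simp add: hyperboloid_def)
  have zz: "Q_form r z z = 1" using z by (simp add: hyperboloid_def)
  have oo: "Q_form r (hyp_origin r) (hyp_origin r) = 1" using hyp_origin_mem[of r] by (simp add: hyperboloid_def)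
  show 1: "Q_form r z (z + hyp_origin r) = 1 + z $ 0"
    by (simp only: Q_form_add_right[OF c oc c] zz Q_form_origin_right[OF c])
  have "Q_form r (hyp_origin r) (z + hyp_origin r) = z $ 0 + 1"
    by (simp only: Q_form_add_right[OF c oc oc] oo Q_form_commute[OF oc c] Q_form_origin_right[OF c])
  then show "Q_form r (z + hyp_origin r) (z + hyp_origin r) = 2 * (1 + z $ 0)"
    using 1 by (simp only: Q_form_add_left[OF c oc m]) simp
qed

lemma Q_form_half_turn:
  assumes x: "x \<in> carrier_vec (Suc r)" and y: "y \<in> carrier_vec (Suc r)"
  shows "Q_form r (half_turn r z x) (half_turn r z y) = Q_form r x y"
proof -
  define m where "m = z + hyp_origin r"
  define s where "s = 1 + z $ 0"
  have m: "m \<in> carrier_vec (Suc r)" and mm: "Q_form r m m = 2 * s" and s: "s > 0"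
    using half_turn_center by (auto simp: m_def s_def)
  have "Q_form r (half_turn r z x) (half_turn r z y)
      = (Q_form r x m / s) * ((Q_form r y m / s) * (2 * s)) - Q_form r x m / s * Q_form r y m
        - Q_form r y m / s * Q_form r x m + Q_form r x y"
    unfolding half_turn_def m_def[symmetric] s_def[symmetric]
    using m x y
    by (simp add: Q_form_diff_left Q_form_diff_right Q_form_smult_left Q_form_smult_right mm
        Q_form_commute[OF m y])
  also have "\<dots> = Q_form r x y" using s by (simp add: field_simps)
  finally show ?thesis .
qed

lemma half_turn_half_turn:
  assumes x: "x \<in> carrier_vec (Suc r)"
  shows "half_turn r z (half_turn r z x) = x"
proof -
  define m where "m = z + hyp_origin r"
  define s where "s = 1 + z $ 0"
  have m: "m \<in> carrier_vec (Suc r)" and mm: "Q_form r m m = 2 * s" and s: "s > 0"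
    using half_turn_center by (auto simp: m_def s_def)
  have T: "half_turn r z x = (Q_form r x m / s) \<cdot>\<^sub>v m - x" for x
    by (simp add: half_turn_def m_def s_def)
  have "Q_form r (half_turn r z x) m = Q_form r x m"
    using m x s by (simp add: T Q_form_diff_left Q_form_smult_left mm)
  then have "half_turn r z (half_turn r z x) = (Q_form r x m / s) \<cdot>\<^sub>v m - ((Q_form r x m / s) \<cdot>\<^sub>v m - x)"
    by (simp only: T[of "half_turn r z x"]) (simp only: T)
  also have "\<dots> = x" using m x by (intro eq_vecI) auto
  finally show ?thesis .
qed

lemma half_turn_base: "half_turn r z z = hyp_origin r"
proof -
  have "half_turn r z z = 1 \<cdot>\<^sub>v (z + hyp_origin r) - z"
    unfolding half_turn_def using half_turn_center by simp
  also have "\<dots> = hyp_origin r"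
    using hyperboloid_carrier[OF z] hyperboloid_carrier[OF hyp_origin_mem[of r]] by (intro eq_vecI) auto
  finally show ?thesis .
qed

text \<open>The image stays on the upper sheet because its time coordinate is its product with the
  origin, the image of \<open>z\<close>; by invariance this is \<open>Q_form r x z\<close>, which is
  at least 1.\<close>

lemma half_turn_hyperboloid:
  assumes x: "x \<in> hyperboloid r"
  shows "half_turn r z x \<in> hyperboloid r"
proof -
  note xc = hyperboloid_carrier[OF x]
  have "half_turn r z x $ 0 = Q_form r x z"
    using Q_form_half_turn[OF xc hyperboloid_carrier[OF z]] half_turn_base
      Q_form_origin_right[OF half_turn_carrier[OF xc]] by simp
  then have "half_turn r z x $ 0 > 0" using Q_form_ge_1[OF x z] by simp
  then show ?thesis
    using Q_form_half_turn[OF xc xc] half_turn_carrier[OF xc] x by (simp add: hyperboloid_def)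
qed

lemma half_turn_isometry: "hyp_isometry r (half_turn r z)"
proof -
  have "bij_betw (half_turn r z) (hyperboloid r) (hyperboloid r)"
    by (rule bij_betwI[where g = "half_turn r z"])
      (auto simp: half_turn_hyperboloid half_turn_half_turn hyperboloid_carrier)
  then show ?thesis
    by (simp add: hyp_isometry_def hyp_dist_def Q_form_half_turn hyperboloid_carrier)
qed

end

text \<open>\<open>Psi\<close> and the neighbourhoods depend on distances only, and by surjectivity
  every competitor of \<open>T z\<close> has the form \<open>T w\<close>.\<close>

lemma pe_mean_isometry:
  assumes T: "hyp_isometry r T" and x: "\<forall>i<n. x i \<in> hyperboloid r" and z: "z \<in> hyperboloid r"
  shows "pe_mean r n (\<lambda>i. T (x i)) (T z) \<longleftrightarrow> pe_mean r n x z"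
proof -
  have bij: "T ` hyperboloid r = hyperboloid r"
    and dist: "\<And>x y. x \<in> hyperboloid r \<Longrightarrow> y \<in> hyperboloid r \<Longrightarrow> hyp_dist r (T x) (T y) = hyp_dist r x y"
    using T by (auto simp: hyp_isometry_def bij_betw_def)
  have Psi: "Psi r n (\<lambda>i. T (x i)) (T w) = Psi r n x w" if "w \<in> hyperboloid r" for w
    using x that by (simp add: Psi_def dist)
  have "(\<forall>w \<in> hyperboloid r. hyp_dist r (T z) w < \<epsilon> \<longrightarrow> Psi r n (\<lambda>i. T (x i)) (T z) \<le> Psi r n (\<lambda>i. T (x i)) w)
      \<longleftrightarrow> (\<forall>w \<in> hyperboloid r. hyp_dist r z w < \<epsilon> \<longrightarrow> Psi r n x z \<le> Psi r n x w)" (is "?l \<longleftrightarrow> ?r") for \<epsilon>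
  proof -
    have "?l \<longleftrightarrow> (\<forall>w \<in> T ` hyperboloid r. hyp_dist r (T z) w < \<epsilon> \<longrightarrow> Psi r n (\<lambda>i. T (x i)) (T z) \<le> Psi r n (\<lambda>i. T (x i)) w)"
      by (simp only: bij)
    then show ?thesis using z by (simp add: dist Psi)
  qed
  moreover have "T z \<in> hyperboloid r" using bij z by blast
  ultimately show ?thesis using z by (simp add: pe_mean_def)
qed

section \<open>Existence of a mean and the matrix of hyperbolic cosines\<close>

lemma Q_form_sum_right:
  assumes y: "y \<in> carrier_vec (Suc r)" and x: "\<forall>i<n. x i \<in> carrier_vec (Suc r)"
  shows "Q_form r y (vec (Suc r) (\<lambda>k. \<Sum>i<n. w i * x i $ k)) = (\<Sum>i<n. w i * Q_form r y (x i))"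
proof -
  have "(\<Sum>k<r. y $ Suc k * (\<Sum>i<n. w i * x i $ Suc k)) = (\<Sum>i<n. w i * (\<Sum>k<r. y $ Suc k * x i $ Suc k))"
    unfolding sum_distrib_left by (subst sum.swap) (simp add: mult.left_commute)
  then have "Q_form r y (vec (Suc r) (\<lambda>k. \<Sum>i<n. w i * x i $ k))
      = (\<Sum>i<n. w i * (y $ 0 * x i $ 0)) - (\<Sum>i<n. w i * (\<Sum>k<r. y $ Suc k * x i $ Suc k))"
    using y by (simp add: Q_form_eq sum_distrib_left mult.left_commute)
  also have "\<dots> = (\<Sum>i<n. w i * (y $ 0 * x i $ 0 - (\<Sum>k<r. y $ Suc k * x i $ Suc k)))"
    by (simp only: sum_subtractf[symmetric] right_diff_distrib)
  also have "\<dots> = (\<Sum>i<n. w i * Q_form r y (x i))"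
    using x y by (intro sum.cong) (auto simp: Q_form_eq)
  finally show ?thesis .
qed

text \<open>\<open>crit\<close> is the Lagrange condition for the quadratic form on
  \<open>Q(z, z) = 1\<close>, with multiplier \<open>\<mu>\<close>. The half-turn carries it to the
  origin, where it says \<open>X^T u = 0\<close>, and there this is already sufficient for a
  minimum.\<close>

lemma pe_mean_if_critical:
  assumes x: "\<forall>i<n. x i \<in> hyperboloid r" and z: "z \<in> hyperboloid r"
    and crit: "\<And>y. y \<in> carrier_vec (Suc r) \<Longrightarrow> (\<Sum>i<n. Q_form r (x i) z * Q_form r (x i) y) = \<mu> * Q_form r z y"
  shows "pe_mean r n x z"
proof -
  let ?T = "half_turn r z"
  have xc: "x i \<in> carrier_vec (Suc r)" if "i < n" for i using x that hyperboloid_carrier by blast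
  note zc = hyperboloid_carrier[OF z]
  have "(\<Sum>i<n. ?T (x i) $ 0 * ?T (x i) $ Suc k) = 0" if k: "k < r" for k
  proof -
    let ?e = "unit_vec (Suc r) (Suc k) :: real vec"
    have e: "?e \<in> carrier_vec (Suc r)" by simp
    have time: "?T (x i) $ 0 = Q_form r (x i) z" if "i < n" for i
      using Q_form_half_turn[OF z xc[OF that] zc] half_turn_base[OF z]
        Q_form_origin_right[OF half_turn_carrier[OF z xc[OF that]]] by simp
    \<comment> \<open>An involution that preserves \<open>Q\<close> is self-adjoint for
      \<open>Q\<close>, so the half-turn can be moved to the basis vector.\<close>
    have space: "?T w $ Suc k = - Q_form r w (?T ?e)" if w: "w \<in> carrier_vec (Suc r)" for w
      using Q_form_half_turn[OF z half_turn_carrier[OF z w] e] half_turn_half_turn[OF z w]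
        Q_form_unit_right[OF half_turn_carrier[OF z w] k] by simp
    have "(\<Sum>i<n. ?T (x i) $ 0 * ?T (x i) $ Suc k) = - (\<Sum>i<n. Q_form r (x i) z * Q_form r (x i) (?T ?e))"
      by (simp add: time space xc sum_negf)
    \<comment> \<open>\<open>crit\<close> is applied to \<open>?T ?e\<close>; moving the half-turn
      back onto \<open>z\<close> leaves a spatial coordinate of the origin.\<close>
    also have "\<dots> = \<mu> * ?T z $ Suc k"
      by (simp add: crit[OF half_turn_carrier[OF z e]] space[OF zc])
    also have "\<dots> = 0" using k by (simp add: half_turn_base[OF z] hyp_origin_def)
    finally show ?thesis .
  qed
  then have "pe_centered r n (\<lambda>i. ?T (x i))"
    using x half_turn_hyperboloid[OF z] by (subst pe_centered_iff) (auto simp: spatial_time_eq_0_iff)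
  then show ?thesis
    using pe_mean_isometry[OF half_turn_isometry[OF z] x z] by (simp add: pe_centered_def half_turn_base[OF z])
qed

lemma cosh_dist_mat_carrier: "cosh_dist_mat r n x \<in> carrier_mat n n"
  by (simp add: cosh_dist_mat_def)

lemma cosh_dist_mat_entry:
  assumes "\<forall>i<n. x i \<in> hyperboloid r" and "i < n" and "j < n"
  shows "cosh_dist_mat r n x $$ (i, j) = Q_form r (x i) (x j)"
  using assms by (simp add: cosh_dist_mat_def cosh_hyp_dist)

lemma cosh_dist_mat_sym:
  assumes x: "\<forall>i<n. x i \<in> hyperboloid r"
  shows "transpose_mat (cosh_dist_mat r n x) = cosh_dist_mat r n x"
proof (rule eq_matI)
  fix i j assume "i < dim_row (cosh_dist_mat r n x)" "j < dim_col (cosh_dist_mat r n x)"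
  then have ij: "i < n" "j < n" by (auto simp: cosh_dist_mat_def)
  have "Q_form r (x j) (x i) = Q_form r (x i) (x j)"
    using x ij by (intro Q_form_commute hyperboloid_carrier) auto
  then show "transpose_mat (cosh_dist_mat r n x) $$ (i, j) = cosh_dist_mat r n x $$ (i, j)"
    using ij cosh_dist_mat_carrier[of r n x] by (simp add: cosh_dist_mat_entry[OF x])
qed (auto simp: cosh_dist_mat_def)

lemma cosh_dist_mat_eq:
  assumes x: "\<forall>i<n. x i \<in> hyperboloid r"
  shows "cosh_dist_mat r n x = outer (time_vec n x) - spatial_mat r n x * transpose_mat (spatial_mat r n x)"
proof (rule eq_matI)
  fix i j
  assume "i < dim_row (outer (time_vec n x) - spatial_mat r n x * transpose_mat (spatial_mat r n x))"
    "j < dim_col (outer (time_vec n x) - spatial_mat r n x * transpose_mat (spatial_mat r n x))"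
  then have ij: "i < n" "j < n" by (auto simp: spatial_mat_def)
  have "(outer (time_vec n x) - spatial_mat r n x * transpose_mat (spatial_mat r n x)) $$ (i, j)
      = x i $ 0 * x j $ 0 - (\<Sum>k<r. x i $ Suc k * x j $ Suc k)"
    using ij by (simp add: outer_def time_vec_def spatial_mat_def scalar_prod_def atLeast0LessThan)
  also have "\<dots> = Q_form r (x i) (x j)"
    using x ij by (intro Q_form_eq[symmetric] hyperboloid_carrier) auto
  finally show "cosh_dist_mat r n x $$ (i, j)
      = (outer (time_vec n x) - spatial_mat r n x * transpose_mat (spatial_mat r n x)) $$ (i, j)"
    using cosh_dist_mat_entry[OF x ij] by simp
qed (auto simp: cosh_dist_mat_def spatial_mat_def)

text \<open>\<open>Y\<close> has trace \<open>n > 0\<close>, hence an eigenvector \<open>w\<close> with positive eigenvalue. The combination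
  \<open>\<Sum>\<^sub>i w\<^sub>i x\<^sub>i\<close> is timelike, and its normalisation is a critical point of \<open>\<Psi>\<close>.\<close>

lemma pe_mean_exists:
  assumes n: "n \<ge> 1" and x: "\<forall>i<n. x i \<in> hyperboloid r"
  shows "\<exists>z. pe_mean r n x z"
proof -
  define Y where "Y = cosh_dist_mat r n x"
  have Y: "Y \<in> carrier_mat n n" by (simp add: Y_def cosh_dist_mat_carrier)
  have xc: "\<forall>i<n. x i \<in> carrier_vec (Suc r)" using x hyperboloid_carrier by blast
  obtain v l where vl: "eigendecomposition Y v l"
    using eigendecomposition_exists[OF Y] cosh_dist_mat_sym[OF x] by (auto simp: Y_def)
  note v = eigendecomposition_carrier[OF Y vl]
  \<comment> \<open>If no eigenvalue were positive, the spectral expansion would make this diagonal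
    entry non-positive.\<close>
  have "Y $$ (0, 0) = 1"
    using n x by (simp add: Y_def cosh_dist_mat_entry[OF x] hyperboloid_def)
  then have pos: "0 < (\<Sum>k<n. l k * v k $ 0 * v k $ 0)"
    using eigendecomposition_entry[OF Y vl, of 0 0] n by simp
  have "\<exists>k<n. 0 < l k"
  proof (rule ccontr)
    assume "\<not> ?thesis"
    then have "l k \<le> 0" if "k < n" for k using that by (meson not_less)
    then have "(\<Sum>k<n. l k * v k $ 0 * v k $ 0) \<le> 0"
      by (intro sum_nonpos) (simp add: mult.assoc mult_nonpos_nonneg)
    then show False using pos by simp
  qed
  then obtain k where k: "k < n" and lk: "0 < l k" by blast
  define w where "w = v k"
  have w: "w \<in> carrier_vec n" and ww: "w \<bullet> w = 1"
    using v(1)[OF k] vl Y k by (auto simp: w_def eigendecomposition_def)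
  define p where "p = vec (Suc r) (\<lambda>k. \<Sum>i<n. w $ i * x i $ k)"
  have p: "p \<in> carrier_vec (Suc r)" by (simp add: p_def)
  have Qp: "Q_form r y p = (\<Sum>i<n. w $ i * Q_form r y (x i))" if "y \<in> carrier_vec (Suc r)" for y
    unfolding p_def by (rule Q_form_sum_right[OF that xc])
  \<comment> \<open>The eigenvalue equation of \<open>Y\<close> in geometric form, as
    \<open>Y\<close> is the Gram matrix of the points for \<open>Q\<close>.\<close>
  have Qxp: "Q_form r (x i) p = l k * w $ i" if i: "i < n" for i
  proof -
    have "Q_form r (x i) p = (\<Sum>j<n. Y $$ (i, j) * w $ j)"
      using xc i by (simp add: Qp Y_def cosh_dist_mat_entry[OF x] mult.commute)
    also have "\<dots> = (Y *\<^sub>v w) $ i" using Y w i by (simp add: scalar_prod_def atLeast0LessThan)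
    also have "\<dots> = l k * w $ i" using v(1,2)[OF k] i by (simp add: w_def)
    finally show ?thesis .
  qed
  have pp: "Q_form r p p = l k"
  proof -
    have "Q_form r p p = (\<Sum>i<n. w $ i * (l k * w $ i))"
      unfolding Qp[OF p] using xc Qxp p by (intro sum.cong) (auto simp: Q_form_commute[of p r "x _"])
    also have "\<dots> = l k * (w \<bullet> w)"
      using w by (simp add: scalar_prod_def atLeast0LessThan sum_distrib_left mult.left_commute)
    finally show ?thesis by (simp add: ww)
  qed
  have p0: "p $ 0 \<noteq> 0"
  proof
    assume "p $ 0 = 0"
    then have "Q_form r p p \<le> 0" using p by (simp add: Q_form_eq sum_nonneg)
    then show False using pp lk by simp
  qed
  \<comment> \<open>The root normalises, since \<open>Q(p, p) = l k\<close>; the sign selects the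
    upper sheet.\<close>
  define c where "c = sgn (p $ 0) / sqrt (l k)"
  define z where "z = c \<cdot>\<^sub>v p"
  have z: "z \<in> hyperboloid r"
  proof -
    have "c * c * l k = 1"
      using lk p0 by (simp add: c_def sgn_if)
    then have "Q_form r z z = 1"
      using p by (simp add: z_def Q_form_smult_left Q_form_smult_right pp)
    moreover have "z $ 0 > 0" using p p0 lk by (simp add: z_def c_def sgn_if)
    ultimately show ?thesis using p by (simp add: hyperboloid_def z_def)
  qed
  have "pe_mean r n x z"
  proof (rule pe_mean_if_critical[OF x z])
    fix y :: "real vec" assume y: "y \<in> carrier_vec (Suc r)"
    have "(\<Sum>i<n. Q_form r (x i) z * Q_form r (x i) y) = (\<Sum>i<n. c * l k * (w $ i * Q_form r y (x i)))"
    proof (rule sum.cong)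
      fix i assume "i \<in> {..<n}"
      then have i: "i < n" by simp
      have "Q_form r (x i) y = Q_form r y (x i)" using xc i y by (intro Q_form_commute) auto
      moreover have "Q_form r (x i) z = c * l k * w $ i"
        using xc i p by (simp add: z_def Q_form_smult_right Qxp)
      ultimately show "Q_form r (x i) z * Q_form r (x i) y = c * l k * (w $ i * Q_form r y (x i))" by simp
    qed simp
    also have "\<dots> = c * l k * Q_form r y p" by (simp only: Qp[OF y] sum_distrib_left)
    also have "\<dots> = l k * Q_form r z y"
      using p y by (simp add: z_def Q_form_smult_left Q_form_commute[of y r p])
    finally show "(\<Sum>i<n. Q_form r (x i) z * Q_form r (x i) y) = l k * Q_form r z y" .
  qed
  then show ?thesis by blast
qed

lemma pe_mean_centering:
  assumes x: "\<forall>i<n. x i \<in> hyperboloid r" and mean: "pe_mean r n x z"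
  shows "\<exists>T. hyp_isometry r T \<and> T z = hyp_origin r
    \<and> cosh_dist_mat r n (\<lambda>i. T (x i)) = cosh_dist_mat r n x
    \<and> pe_centered r n (\<lambda>i. T (x i))
    \<and> transpose_mat (spatial_mat r n (\<lambda>i. T (x i))) *\<^sub>v time_vec n (\<lambda>i. T (x i)) = 0\<^sub>v r"
proof -
  let ?T = "half_turn r z"
  have z: "z \<in> hyperboloid r" using mean by (simp add: pe_mean_def)
  note T = half_turn_isometry[OF z] and Tz = half_turn_base[OF z]
  have Tx: "\<forall>i<n. ?T (x i) \<in> hyperboloid r" using x half_turn_hyperboloid[OF z] by blast
  have "cosh_dist_mat r n (\<lambda>i. ?T (x i)) = cosh_dist_mat r n x"
    using x T by (intro eq_matI) (auto simp: cosh_dist_mat_def hyp_isometry_def)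
  moreover have "pe_centered r n (\<lambda>i. ?T (x i))"
    using pe_mean_isometry[OF T x z] mean by (simp add: pe_centered_def Tz)
  ultimately show ?thesis using T Tz pe_centered_iff[OF Tx] by blast
qed

text \<open>The diagonal of the Gram matrix holds the squared norms of the spatial parts, which a
  rotation does not change. The positive root is the right one on the upper sheet.\<close>

lemma time_of_spatial_eq:
  assumes x: "\<forall>i<n. x i \<in> hyperboloid r" and Xh: "Xh \<in> carrier_mat n r"
    and gram: "Xh * transpose_mat Xh = spatial_mat r n x * transpose_mat (spatial_mat r n x)"
  shows "time_vec n x = time_of_spatial Xh"
proof (rule eq_vecI)
  fix i assume "i < dim_vec (time_of_spatial Xh)"
  then have i: "i < n" using Xh by (simp add: time_of_spatial_def)
  have "row Xh i \<bullet> row Xh i = (spatial_mat r n x * transpose_mat (spatial_mat r n x)) $$ (i, i)"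
    using arg_cong[OF gram, of "\<lambda>M. M $$ (i, i)"] Xh i by simp
  also have "\<dots> = (\<Sum>k<r. (x i $ Suc k)\<^sup>2)"
    using i by (simp add: spatial_mat_def scalar_prod_def atLeast0LessThan power2_eq_square)
  finally have "1 + row Xh i \<bullet> row Xh i = (x i $ 0)\<^sup>2"
    using hyperboloid_time_sq[of "x i" r] x i by simp
  moreover have "0 < x i $ 0" using x i by (simp add: hyperboloid_def)
  ultimately show "time_vec n x $ i = time_of_spatial Xh $ i"
    using i Xh by (simp add: time_vec_def time_of_spatial_def)
qed (use Xh in \<open>simp add: time_vec_def time_of_spatial_def\<close>)

section \<open>Recovery of the points\<close>

text \<open>Recovery is claimed for all eigendecompositions and all PCA outputs because neither is
  unique; existence is stated beside it so that the claims are not vacuous. The eigenvalue clause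
  admits 0 only on the kernel of \<open>X^T\<close>.\<close>

theorem mainTheorem4:
  fixes n r :: nat and x :: "nat \<Rightarrow> real vec" and X Y :: "real mat" and u :: "real vec"
  assumes "n \<ge> 1"
    and "\<forall>i<n. x i \<in> hyperboloid r"
    and "Y = cosh_dist_mat r n x"
    and "X = spatial_mat r n x"
    and "u = time_vec n x"
  shows
    "Y = outer u - X * transpose_mat X
     \<and> (\<exists>z. pe_mean r n x z)
     \<and> (\<forall>z. pe_mean r n x z \<longrightarrow>
          (\<exists>T. hyp_isometry r T \<and> T z = hyp_origin r
             \<and> cosh_dist_mat r n (\<lambda>i. T (x i)) = Y
             \<and> pe_centered r n (\<lambda>i. T (x i))
             \<and> transpose_mat (spatial_mat r n (\<lambda>i. T (x i))) *\<^sub>v time_vec n (\<lambda>i. T (x i)) = 0\<^sub>v r))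
     \<and> (pe_centered r n x \<longleftrightarrow> transpose_mat X *\<^sub>v u = 0\<^sub>v r)
     \<and> (pe_centered r n x \<longrightarrow>
          (\<exists>\<mu>>0. eigenvector Y u \<mu>
             \<and> (\<exists>es. char_poly Y = [:- \<mu>, 1:] * (\<Prod>e\<leftarrow>es. [:- e, 1:]) \<and> (\<forall>e \<in> set es. e \<le> 0))
             \<and> (\<forall>w \<nu>. eigenvector Y w \<nu> \<and> \<nu> \<noteq> \<mu> \<longrightarrow>
                  \<nu> < 0 \<or> (\<nu> = 0 \<and> transpose_mat X *\<^sub>v w = 0\<^sub>v r)))
          \<and> (\<exists>v l. eigendecomposition Y v l)
          \<and> (\<forall>v l. eigendecomposition Y v l \<longrightarrow>
               (u = eig_time v l \<or> u = - eig_time v l)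
               \<and> Y = outer u - eig_spatial r n v l * transpose_mat (eig_spatial r n v l)
               \<and> (\<exists>R \<in> orthogonal_group r. eig_spatial r n v l = X * R))
          \<and> (\<forall>Xh \<in> carrier_mat n r. Y = outer u - Xh * transpose_mat Xh \<longrightarrow>
               (\<exists>R \<in> orthogonal_group r. Xh = X * R))
          \<and> - Y = X * transpose_mat X - outer u
          \<and> (\<exists>Xh. pca r (- Y) Xh)
          \<and> (\<forall>Xh. pca r (- Y) Xh \<longrightarrow>
               (\<exists>R \<in> orthogonal_group r. Xh = X * R) \<and> u = time_of_spatial Xh))"
proof -
  note x = assms(2) and Y_def = assms(3) and X_def = assms(4) and u_def = assms(5)
  have X: "X \<in> carrier_mat n r" by (simp add: X_def spatial_mat_def)
  have u: "u \<in> carrier_vec n" by (simp add: u_def time_vec_def)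
  have Y_eq: "Y = outer u - X * transpose_mat X"
    unfolding Y_def X_def u_def by (rule cosh_dist_mat_eq[OF x])
  have centered_iff: "pe_centered r n x \<longleftrightarrow> transpose_mat X *\<^sub>v u = 0\<^sub>v r"
    unfolding X_def u_def by (rule pe_centered_iff[OF x])
  have centering: "\<forall>z. pe_mean r n x z \<longrightarrow>
          (\<exists>T. hyp_isometry r T \<and> T z = hyp_origin r
             \<and> cosh_dist_mat r n (\<lambda>i. T (x i)) = Y
             \<and> pe_centered r n (\<lambda>i. T (x i))
             \<and> transpose_mat (spatial_mat r n (\<lambda>i. T (x i))) *\<^sub>v time_vec n (\<lambda>i. T (x i)) = 0\<^sub>v r)"
    unfolding Y_def using pe_mean_centering[OF x] by blast
  have recovery: "(\<exists>\<mu>>0. eigenvector Y u \<mu>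
             \<and> (\<exists>es. char_poly Y = [:- \<mu>, 1:] * (\<Prod>e\<leftarrow>es. [:- e, 1:]) \<and> (\<forall>e \<in> set es. e \<le> 0))
             \<and> (\<forall>w \<nu>. eigenvector Y w \<nu> \<and> \<nu> \<noteq> \<mu> \<longrightarrow>
                  \<nu> < 0 \<or> (\<nu> = 0 \<and> transpose_mat X *\<^sub>v w = 0\<^sub>v r)))
          \<and> (\<exists>v l. eigendecomposition Y v l)
          \<and> (\<forall>v l. eigendecomposition Y v l \<longrightarrow>
               (u = eig_time v l \<or> u = - eig_time v l)
               \<and> Y = outer u - eig_spatial r n v l * transpose_mat (eig_spatial r n v l)
               \<and> (\<exists>R \<in> orthogonal_group r. eig_spatial r n v l = X * R))
          \<and> (\<forall>Xh \<in> carrier_mat n r. Y = outer u - Xh * transpose_mat Xh \<longrightarrow>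
               (\<exists>R \<in> orthogonal_group r. Xh = X * R))
          \<and> - Y = X * transpose_mat X - outer u
          \<and> (\<exists>Xh. pca r (- Y) Xh)
          \<and> (\<forall>Xh. pca r (- Y) Xh \<longrightarrow>
               (\<exists>R \<in> orthogonal_group r. Xh = X * R) \<and> u = time_of_spatial Xh)"
    if pc: "pe_centered r n x"
  proof -
    \<comment> \<open>With at least one point, a positive time coordinate makes \<open>u\<close>
      nonzero, as an eigenvector must be.\<close>
    have "u $ 0 > 0" using x assms(1) by (simp add: u_def time_vec_def hyperboloid_def)
    then have "u \<noteq> 0\<^sub>v n" using assms(1) by auto
    then interpret centered_factorization n r X Y u
      using X u Y_eq centered_iff pc by unfold_locales auto
    have spatial: "eig_spatial r n v l \<in> carrier_mat n r" for v l by (simp add: eig_spatial_def)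
    have eq: "Y = outer u - eig_spatial r n v l * transpose_mat (eig_spatial r n v l)"
      if "eigendecomposition Y v l" for v l
      using Y_eq eig_spatial_gram[OF that] by simp
    have 1: "\<exists>\<mu>>0. eigenvector Y u \<mu>
             \<and> (\<exists>es. char_poly Y = [:- \<mu>, 1:] * (\<Prod>e\<leftarrow>es. [:- e, 1:]) \<and> (\<forall>e \<in> set es. e \<le> 0))
             \<and> (\<forall>w \<nu>. eigenvector Y w \<nu> \<and> \<nu> \<noteq> \<mu> \<longrightarrow>
                  \<nu> < 0 \<or> (\<nu> = 0 \<and> transpose_mat X *\<^sub>v w = 0\<^sub>v r))"
      using mu_pos eigenvector_u char_poly_Y eigenvalue_orthogonal eigenvector_orthogonal
      by (intro exI[of _ "u \<bullet> u"] conjI) blast+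
    have 2: "\<exists>v l. eigendecomposition Y v l" by (rule eigendecomposition_exists[OF Y Y_sym])
    have 3: "(u = eig_time v l \<or> u = - eig_time v l)
               \<and> Y = outer u - eig_spatial r n v l * transpose_mat (eig_spatial r n v l)
               \<and> (\<exists>R \<in> orthogonal_group r. eig_spatial r n v l = X * R)"
      if vl: "eigendecomposition Y v l" for v l
      using u_eq_eig_time[OF vl] eq[OF vl] factor_unique[OF spatial eq[OF vl]] by blast
    have 4: "- Y = X * transpose_mat X - outer u"
      by (rule eq_matI) (use X u in \<open>auto simp: Y_eq outer_def\<close>)
    have 5: "(\<exists>R \<in> orthogonal_group r. Xh = X * R) \<and> u = time_of_spatial Xh" if "pca r (- Y) Xh" for Xh
    proof -
      obtain v l where vl: "eigendecomposition Y v l" and Xh: "Xh = eig_spatial r n v l"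
        using pca_eq_eig_spatial[OF \<open>pca r (- Y) Xh\<close>] by blast
      have "u = time_of_spatial Xh"
        unfolding u_def Xh
        by (rule time_of_spatial_eq[OF x spatial]) (use eig_spatial_gram[OF vl] in \<open>simp add: X_def\<close>)
      then show ?thesis using 3[OF vl] Xh by blast
    qed
    show ?thesis using 1 2 3 4 5 factor_unique pca_exists by blast
  qed
  show ?thesis
    using Y_eq pe_mean_exists[OF assms(1) x] centering centered_iff recovery by blast
qed

end
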